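(* There exist $\beta\in(0,1)$ and a domain $D$ with an algebraic boundary $\varGamma$ of order $4$ such that, for the elliptic operator $L=L_\beta$, the domain $D$ is $L$-special with an admissible pair $(F_1,F_2)$ consisting of polynomials (in one complex variable, with complex coefficients).
   Context: Identify $\mathbb{R}^2$ with $\mathbb{C}$ via $z=x+iy$. Operator. For $\beta\in(0,1)$, $L_\beta=c\,\overline{\partial}\,\partial_\beta$, where $c\in\mathbb{C}\setminus\{0\}$, $\overline{\partial}=\frac12(\partial/\partial x+i\,\partial/\partial y)$ and $\partial_\beta=\frac12(\partial/\partial x+i\beta\,\partial/\partial y)$. Associated with $L_\beta$ is the real-linear transformation of the plane $T_\beta: z=x+iy\mapsto z_\beta=x+\frac{i}{\beta}y$. Carathéodory domains and the class $AC$. A bounded domain $D\subset\mathbb{R}^2$ is a Carathéodory domain if $\partial D=\partial D_\infty$, where $D_\infty$ is the unbounded connected component of $\mathbb{R}^2\setminus\overline{D}$; such a domain is simply connected. Let $\varphi$ be a conformal mapping of the unit disc $\mathbb{D}=\{|z|<1\}$ onto $D$. A holomorphic function $f$ in $D$ belongs to $AC(D)$ if $f\circ\varphi$ extends to a function that is continuous on $\overline{\mathbb{D}}$ and absolutely continuous on the unit circle. For $f\in AC(D)$ and an accessible boundary point $\zeta$ of $D$, the limits of $f$ along all paths lying in $D\cup\{\zeta\}$ and ending at $\zeta$ exist and are equal to a common value, denoted $f(\zeta)$ (the boundary value of $f$ at $\zeta$). $L$-special domains. For $L=L_\beta$, a Carathéodory domain $D$ is $L$-special if there exist two non-constant functions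 $F_1\in AC(D)$ and $F_2\in AC(T_\beta D)$ such that $F_1(\zeta)=F_2(T_\beta\zeta)$ for every accessible boundary point $\zeta\in\partial D$. Any such pair $(F_1,F_2)$ is called admissible for $D$ (it is not unique). Algebraic boundaries. A Jordan curve $\varGamma\subset\mathbb{R}^2$ is algebraic if $\varGamma\subset\{(x,y)\in\mathbb{R}^2:P(x,y)=0\}$ for some nonzero $P\in\mathbb{C}[x,y]$; in this case one says that $P$ defines $\varGamma$. The order of an algebraic curve $\varGamma$ is the smallest $n$ such that there is a polynomial of degree $n$ defining $\varGamma$. A domain with an algebraic boundary is a Jordan domain that is the interior of a closed Jordan algebraic curve; the order of the boundary is the order of this curve. *)

theory Defs
  imports
    "HOL-Complex_Analysis.Complex_Analysis"
    "HOL-Computational_Algebra.Polynomial"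
begin

section \<open>The operator and the associated linear transformation\<close>

definition partial_x :: "(complex \<Rightarrow> complex) \<Rightarrow> complex \<Rightarrow> complex" where
  "partial_x f z = vector_derivative (\<lambda>t. f (z + of_real t)) (at 0)"

definition partial_y :: "(complex \<Rightarrow> complex) \<Rightarrow> complex \<Rightarrow> complex" where
  "partial_y f z = vector_derivative (\<lambda>t. f (z + \<i> * of_real t)) (at 0)"

text \<open>For \<open>b = 1\<close> this is the Cauchy--Riemann operator.\<close>

definition cr_op :: "real \<Rightarrow> (complex \<Rightarrow> complex) \<Rightarrow> complex \<Rightarrow> complex" where
  "cr_op b f z = (partial_x f z + \<i> * of_real b * partial_y f z) / 2"

definition L_op :: "complex \<Rightarrow> real \<Rightarrow> (complex \<Rightarrow> complex) \<Rightarrow> complex \<Rightarrow> complex" where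
  "L_op c \<beta> f z = c * cr_op 1 (cr_op \<beta> f) z"

definition T_map :: "real \<Rightarrow> complex \<Rightarrow> complex" where
  "T_map \<beta> z = Complex (Re z) (Im z / \<beta>)"


section \<open>Caratheodory domains and the class AC\<close>

text \<open>\<open>outside S\<close> is the union of the unbounded components of \<open>- S\<close>; in the plane, a
  bounded set has exactly one such component.\<close>

definition caratheodory_domain :: "complex set \<Rightarrow> bool" where
  "caratheodory_domain D \<longleftrightarrow>
     open D \<and> connected D \<and> D \<noteq> {} \<and> bounded D \<and>
     frontier D = frontier (outside (closure D))"

definition conformal_map_of_disc :: "(complex \<Rightarrow> complex) \<Rightarrow> complex set \<Rightarrow> bool" where
  "conformal_map_of_disc \<phi> D \<longleftrightarrow>
     \<phi> holomorphic_on ball 0 1 \<and> inj_on \<phi> (ball 0 1) \<and> \<phi> ` ball 0 1 = D"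

text \<open>The usual epsilon-delta definition; finite families of nonoverlapping closed
  subintervals \<open>K = {s..t}\<close> are given by \<open>division_of\<close>, with \<open>s = Inf K\<close> and \<open>t = Sup K\<close>.\<close>

definition abs_continuous_on :: "real set \<Rightarrow> (real \<Rightarrow> complex) \<Rightarrow> bool" where
  "abs_continuous_on S f \<longleftrightarrow>
     (\<forall>\<epsilon>>0. \<exists>\<delta>>0. \<forall>\<D>. \<D> division_of \<Union>\<D> \<and> \<Union>\<D> \<subseteq> S \<and> (\<Sum>K\<in>\<D>. Sup K - Inf K) < \<delta> \<longrightarrow>
        (\<Sum>K\<in>\<D>. norm (f (Sup K) - f (Inf K))) < \<epsilon>)"

text \<open>The condition does not depend on the conformal map: two such maps differ by an
  automorphism of the disc, which is smooth up to the boundary.\<close>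

definition AC :: "complex set \<Rightarrow> (complex \<Rightarrow> complex) set" where
  "AC D = {f. f holomorphic_on D \<and>
     (\<exists>\<phi> g. conformal_map_of_disc \<phi> D \<and>
        (\<forall>w\<in>ball 0 1. g w = f (\<phi> w)) \<and>
        continuous_on (cball 0 1) g \<and>
        abs_continuous_on {0..2 * pi} (\<lambda>t. g (cis t)))}"

definition access_path :: "complex set \<Rightarrow> complex \<Rightarrow> (real \<Rightarrow> complex) \<Rightarrow> bool" where
  "access_path D \<zeta> \<gamma> \<longleftrightarrow> path \<gamma> \<and> \<gamma> ` {0..<1} \<subseteq> D \<and> pathfinish \<gamma> = \<zeta>"

definition accessible_boundary_point :: "complex set \<Rightarrow> complex \<Rightarrow> bool" where
  "accessible_boundary_point D \<zeta> \<longleftrightarrow> \<zeta> \<in> frontier D \<and> (\<exists>\<gamma>. access_path D \<zeta> \<gamma>)"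

text \<open>For accessible \<open>\<zeta>\<close> there is at most one such value \<open>w\<close>.\<close>

definition has_boundary_value ::
    "complex set \<Rightarrow> (complex \<Rightarrow> complex) \<Rightarrow> complex \<Rightarrow> complex \<Rightarrow> bool" where
  "has_boundary_value D f \<zeta> w \<longleftrightarrow>
     (\<forall>\<gamma>. access_path D \<zeta> \<gamma> \<longrightarrow> ((f \<circ> \<gamma>) \<longlongrightarrow> w) (at_left 1))"


section \<open>L-special domains\<close>

text \<open>The operator \<open>L_op c \<beta>\<close> determines \<open>c\<close> and \<open>\<beta>\<close>, as one sees by applying it to
  \<open>x\<^sup>2\<close> and \<open>x y\<close>. The equation between \<open>F\<^sub>1 (\<zeta>)\<close> and \<open>F\<^sub>2 (T \<zeta>)\<close> includes the existence
  of the two boundary values.\<close>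

definition admissible_pair ::
    "((complex \<Rightarrow> complex) \<Rightarrow> complex \<Rightarrow> complex) \<Rightarrow> complex set \<Rightarrow>
     (complex \<Rightarrow> complex) \<Rightarrow> (complex \<Rightarrow> complex) \<Rightarrow> bool" where
  "admissible_pair L D F1 F2 \<longleftrightarrow>
     (\<exists>c \<beta>. c \<noteq> 0 \<and> 0 < \<beta> \<and> \<beta> < 1 \<and> L = L_op c \<beta> \<and>
        F1 \<in> AC D \<and> F2 \<in> AC (T_map \<beta> ` D) \<and>
        \<not> F1 constant_on D \<and> \<not> F2 constant_on (T_map \<beta> ` D) \<and>
        (\<forall>\<zeta>. accessible_boundary_point D \<zeta> \<longrightarrow>
           (\<exists>w. has_boundary_value D F1 \<zeta> w \<and>
                has_boundary_value (T_map \<beta> ` D) F2 (T_map \<beta> \<zeta>) w)))"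

definition L_special ::
    "((complex \<Rightarrow> complex) \<Rightarrow> complex \<Rightarrow> complex) \<Rightarrow> complex set \<Rightarrow> bool" where
  "L_special L D \<longleftrightarrow> caratheodory_domain D \<and> (\<exists>F1 F2. admissible_pair L D F1 F2)"


section \<open>Algebraic boundaries\<close>

text \<open>A polynomial in \<open>x\<close>, \<open>y\<close> is represented as a polynomial in \<open>y\<close> with coefficients
  in \<open>\<complex>[x]\<close>: \<open>coeff (coeff P j) i\<close> is the coefficient of \<open>x\<^sup>i y\<^sup>j\<close>.\<close>

definition eval_xy :: "complex poly poly \<Rightarrow> real \<Rightarrow> real \<Rightarrow> complex" where
  "eval_xy P x y = poly (poly P [:of_real y:]) (of_real x)"

text \<open>Total degree, meaningful for nonzero polynomials.\<close>

definition total_degree :: "complex poly poly \<Rightarrow> nat" where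
  "total_degree P = Max {i + j |i j. coeff (coeff P j) i \<noteq> 0}"

definition defines_curve :: "complex poly poly \<Rightarrow> complex set \<Rightarrow> bool" where
  "defines_curve P \<Gamma> \<longleftrightarrow> P \<noteq> 0 \<and> (\<forall>z\<in>\<Gamma>. eval_xy P (Re z) (Im z) = 0)"

definition jordan_curve :: "complex set \<Rightarrow> bool" where
  "jordan_curve \<Gamma> \<longleftrightarrow>
     (\<exists>\<gamma>. simple_path \<gamma> \<and> pathfinish \<gamma> = pathstart \<gamma> \<and> path_image \<gamma> = \<Gamma>)"

definition algebraic_jordan_curve :: "complex set \<Rightarrow> bool" where
  "algebraic_jordan_curve \<Gamma> \<longleftrightarrow> jordan_curve \<Gamma> \<and> (\<exists>P. defines_curve P \<Gamma>)"

definition curve_order :: "complex set \<Rightarrow> nat" where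
  "curve_order \<Gamma> = (LEAST n. \<exists>P. defines_curve P \<Gamma> \<and> total_degree P = n)"

definition domain_with_algebraic_boundary :: "complex set \<Rightarrow> complex set \<Rightarrow> bool" where
  "domain_with_algebraic_boundary D \<Gamma> \<longleftrightarrow> algebraic_jordan_curve \<Gamma> \<and> D = inside \<Gamma>"

end

(*
  For polynomials p(u) - p(t) = (u - t) h(u, t), a curve contained in {h = 0}, with u = z and
  t = - b z_beta, carries the boundary identity p(z) = q(z_beta), q(v) = p(- b v).  For
  p(z) = z^5 - z one has h(u, t) = (u^5 - t^5) / (u - t) - 1, and for beta = b^2 the quartic form
  (u^5 - t^5) / (u - t) is real on the plane precisely when b^4 - 6 b^3 + 6 b^2 - 6 b + 1 = 0; it is
  then H = A x^4 - 10 x^2 y^2 + (A / b^4) y^4, positive definite, and D = {H < 1} works.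

  Membership of polynomials in AC(D) follows from boundedness of the derivative of a Riemann map
  phi of D.  A point z = phi(w) of D near the boundary lies at depth delta in a disc contained in D
  and at distance O(delta) from a disc of fixed radius disjoint from D.  Schwarz-Pick on the
  interior disc gives delta <= C (1 - |w|); Schwarz-Pick for phi followed by inversion in the
  exterior disc gives |phi'(w)| (1 - |w|) <= C delta.
*)

theory Submission
  imports Defs
begin

section \<open>Schwarz--Pick estimates\<close>

text \<open>Degree 5 is taken because \<open>h\<close> has total degree one less than
  \<open>p\<close>. With \<open>Y = i y / b\<close> one has \<open>z = x + b Y\<close> and
  \<open>b z_beta = b x + Y\<close>, so exchanging \<open>x\<close> and \<open>Y\<close> exchanges
  the two arguments. The quartic form is therefore symmetric in \<open>x\<close> and
  \<open>Y\<close>; it is real when the odd powers of \<open>Y\<close> are absent, and by symmetry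
  this is one equation in \<open>b\<close>. The sign in \<open>t = - b z_beta\<close> turns the line
  \<open>u = t\<close> into \<open>x + Y = 0\<close>, which meets the real plane only at the origin.
  The exchange is also realised, up to powers of \<open>i\<close>, by a real linear map preserving
  \<open>D\<close>; hence \<open>T_beta D = (i / b) D\<close>, and the AC condition on the image
  reduces to the one on \<open>D\<close>. Two obstacles remain. The Riemann map is not explicit, so
  its boundary regularity is extracted from discs on both sides of the curve, found by a
  second-order Taylor bound for \<open>H\<close>. And order exactly 4 means excluding every complex
  cubic, which the reflections in the axes split into even conics.\<close>

lemma one_minus_norm_moebius:
  fixes w z :: complex
  assumes "1 - cnj w * z \<noteq> 0"
  shows "1 - (norm ((z - w) / (1 - cnj w * z)))\<^sup>2
       = (1 - (norm w)\<^sup>2) * (1 - (norm z)\<^sup>2) / (norm (1 - cnj w * z))\<^sup>2"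
proof -
  have "(norm (1 - cnj w * z))\<^sup>2 - (norm (z - w))\<^sup>2 = (1 - (norm w)\<^sup>2) * (1 - (norm z)\<^sup>2)"
    unfolding cmod_power2 by (simp add: power2_eq_square algebra_simps)
  then show ?thesis
    using assms by (simp add: norm_divide power_divide divide_simps)
qed

lemma one_minus_cnj_mult_nonzero:
  fixes w z :: complex
  assumes "norm w < 1" "norm z < 1"
  shows "1 - cnj w * z \<noteq> 0"
proof
  assume "1 - cnj w * z = 0"
  then have "norm (cnj w * z) = 1" by (metis norm_one right_minus_eq)
  then show False using norm_mult_less[of "cnj w" 1 z 1] assms by simp
qed

text \<open>Moving \<open>f 0\<close> to the origin and applying the Schwarz lemma shows that
  \<open>f w\<close> approaches the unit circle no faster than \<open>w\<close>. The 4 bounds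
  \<open>(1 + norm a) * (1 + norm b)\<close>.\<close>

lemma Schwarz_Pick_centre:
  assumes holf: "f holomorphic_on ball 0 1"
    and f1: "\<And>z. norm z < 1 \<Longrightarrow> norm (f z) < 1"
    and w: "norm w < 1"
  shows "(1 - norm w) * (1 - norm (f 0)) \<le> 4 * (1 - norm (f w))"
proof -
  define a where "a = f 0"
  have a: "norm a < 1" using f1[of 0] by (simp add: a_def)
  define h where "h = (\<lambda>z. Moebius_function 0 a (f z))"
  have "h holomorphic_on ball 0 1"
    unfolding h_def
    by (rule holomorphic_on_compose_gen[OF holf Moebius_function_holomorphic[OF a], unfolded o_def])
       (use f1 in auto)
  moreover have "h 0 = 0" by (simp add: h_def a_def Moebius_function_eq_zero)
  moreover have "norm (h z) < 1" if "norm z < 1" for z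
    using that a f1 by (simp add: h_def Moebius_function_norm_lt_1)
  ultimately have hw: "norm (h w) \<le> norm w" using Schwarz_Lemma(1) w by blast
  define b where "b = f w"
  have b: "norm b < 1" using f1 w by (simp add: b_def)
  have nz: "1 - cnj a * b \<noteq> 0" by (rule one_minus_cnj_mult_nonzero[OF a b])
  have h_eq: "h w = (b - a) / (1 - cnj a * b)"
    by (simp add: h_def b_def Moebius_function_simple)
  have "1 - norm a \<le> norm (1 - cnj a * b)"
  proof -
    have "norm (cnj a * b) \<le> norm a"
      using a b by (simp add: norm_mult mult_left_le)
    moreover have "norm (1::complex) - norm (cnj a * b) \<le> norm (1 - cnj a * b)"
      by (rule norm_triangle_ineq2)
    ultimately show ?thesis by simp
  qed
  then have den: "(1 - norm a)\<^sup>2 \<le> (norm (1 - cnj a * b))\<^sup>2"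
    using a by (intro power_mono) auto
  have "1 - norm w \<le> 1 - (norm w)\<^sup>2"
    using w by (simp add: power2_eq_square mult_left_le)
  also have "\<dots> \<le> 1 - (norm (h w))\<^sup>2"
    using hw by (simp add: power_mono)
  also have "\<dots> = (1 - (norm a)\<^sup>2) * (1 - (norm b)\<^sup>2) / (norm (1 - cnj a * b))\<^sup>2"
    unfolding h_eq by (rule one_minus_norm_moebius[OF nz])
  also have "\<dots> \<le> (1 - (norm a)\<^sup>2) * (1 - (norm b)\<^sup>2) / (1 - norm a)\<^sup>2"
  proof (intro divide_left_mono den mult_nonneg_nonneg mult_pos_pos)
    show "0 < (norm (1 - cnj a * b))\<^sup>2" using nz by (simp only: zero_less_power2 norm_eq_zero) simp
  qed (use a b in \<open>auto simp: power_le_one\<close>)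
  finally have "(1 - norm w) * (1 - norm a)\<^sup>2 \<le> (1 - (norm a)\<^sup>2) * (1 - (norm b)\<^sup>2)"
    using a by (simp add: pos_le_divide_eq)
  then have "((1 - norm w) * (1 - norm a)) * (1 - norm a)
      \<le> ((1 + norm a) * (1 + norm b) * (1 - norm b)) * (1 - norm a)"
    by (simp add: power2_eq_square algebra_simps)
  then have "(1 - norm w) * (1 - norm a) \<le> (1 + norm a) * (1 + norm b) * (1 - norm b)"
    using a by (simp add: mult_le_cancel_right)
  also have "\<dots> \<le> (2 * 2) * (1 - norm b)"
    using a b by (intro mult_right_mono mult_mono) auto
  finally show ?thesis by (simp add: a_def b_def)
qed

text \<open>Composing with disc automorphisms that move \<open>w\<close> and \<open>f w\<close> to 0
  reduces the claim to the derivative bound of the Schwarz lemma.\<close>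

lemma Schwarz_Pick_deriv:
  assumes holf: "f holomorphic_on ball 0 1"
    and f1: "\<And>z. norm z < 1 \<Longrightarrow> norm (f z) < 1"
    and w: "norm w < 1"
  shows "norm (deriv f w) * (1 - (norm w)\<^sup>2) \<le> 1 - (norm (f w))\<^sup>2"
proof -
  define b where "b = f w"
  have b: "norm b < 1" using f1 w by (simp add: b_def)
  define m where "m = (\<lambda>z. (z + w) / (1 + cnj w * z))"
  define k where "k = (\<lambda>z. (z - b) / (1 - cnj b * z))"
  have mM: "m = Moebius_function 0 (- w)" and kM: "k = Moebius_function 0 b"
    by (auto simp: m_def k_def Moebius_function_simple)
  have m1: "norm (m z) < 1" if "norm z < 1" for z
    unfolding mM by (rule Moebius_function_norm_lt_1) (use w that in auto)
  have holm: "m holomorphic_on ball 0 1" and holk: "k holomorphic_on ball 0 1"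
    unfolding mM kM by (rule Moebius_function_holomorphic, use w b in simp)+
  have m0: "m 0 = w" by (simp add: m_def)
  have "(\<lambda>z. k (f (m z))) holomorphic_on ball 0 1"
    by (rule holomorphic_on_compose_gen[OF _ holk, unfolded o_def],
        rule holomorphic_on_compose_gen[OF holm holf, unfolded o_def]) (use m1 f1 in auto)
  moreover have "k (f (m 0)) = 0" by (simp add: m0 k_def b_def)
  moreover have "norm (k (f (m z))) < 1" if "norm z < 1" for z
    unfolding kM by (rule Moebius_function_norm_lt_1) (use b f1 m1 that in auto)
  ultimately have le: "norm (deriv (\<lambda>z. k (f (m z))) 0) \<le> 1"
    by (intro Schwarz_Lemma(2)[where \<xi> = 0]) auto
  have "(m has_field_derivative (1 - w * cnj w)) (at 0)"
    unfolding m_def by (auto intro!: derivative_eq_intros)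
  moreover have "(f has_field_derivative deriv f w) (at w)"
    using holf w by (intro holomorphic_derivI[of _ "ball 0 1"]) auto
  moreover have nz: "1 - cnj b * b \<noteq> 0" by (rule one_minus_cnj_mult_nonzero[OF b b])
  then have "(k has_field_derivative (1 / (1 - cnj b * b))) (at b)"
    unfolding k_def by (auto intro!: derivative_eq_intros simp: divide_simps)
  ultimately have "((\<lambda>z. k (f (m z))) has_field_derivative
      (1 / (1 - cnj b * b)) * (deriv f w * (1 - w * cnj w))) (at 0)"
    using m0 b_def by (intro DERIV_chain2[of k] DERIV_chain2[of f]) auto
  then have "deriv (\<lambda>z. k (f (m z))) 0 = deriv f w * (1 - w * cnj w) / (1 - cnj b * b)"
    by (simp add: DERIV_imp_deriv)
  moreover have "1 - w * cnj w = of_real (1 - (norm w)\<^sup>2)" "1 - cnj b * b = of_real (1 - (norm b)\<^sup>2)"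
    by (simp_all add: complex_norm_square[symmetric] mult.commute)
  ultimately have "norm (deriv f w) * \<bar>1 - (norm w)\<^sup>2\<bar> / \<bar>1 - (norm b)\<^sup>2\<bar> \<le> 1"
    using le by (simp add: norm_divide norm_mult del: of_real_diff)
  moreover have "(norm w)\<^sup>2 < 1" "(norm b)\<^sup>2 < 1"
    using w b by (simp_all add: abs_square_less_1)
  ultimately show ?thesis by (simp add: b_def pos_divide_le_eq)
qed

section \<open>Riemann maps with bounded derivative\<close>

lemma lipschitz_imp_abs_continuous_on:
  assumes "C-lipschitz_on S f"
  shows "abs_continuous_on S f"
  unfolding abs_continuous_on_def
proof (intro allI impI)
  fix \<epsilon> :: real assume \<epsilon>: "\<epsilon> > 0"
  have C: "C \<ge> 0" by (rule lipschitz_on_nonneg[OF assms])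
  show "\<exists>\<delta>>0. \<forall>\<D>. \<D> division_of \<Union>\<D> \<and> \<Union>\<D> \<subseteq> S \<and> (\<Sum>K\<in>\<D>. Sup K - Inf K) < \<delta> \<longrightarrow>
        (\<Sum>K\<in>\<D>. norm (f (Sup K) - f (Inf K))) < \<epsilon>"
  \<comment> \<open>The summand 1 in the denominator covers the case \<open>C = 0\<close>.\<close>
  proof (intro exI[of _ "\<epsilon> / (C + 1)"] conjI allI impI, goal_cases)
    case 1
    show ?case using \<epsilon> C by simp
  next
    case (2 \<D>)
    have "norm (f (Sup K) - f (Inf K)) \<le> C * (Sup K - Inf K)" if K: "K \<in> \<D>" for K
    proof -
      obtain a b where ab: "K = {a..b}" "K \<noteq> {}"
        using division_ofD(3,4)[OF conjunct1[OF 2] K] by auto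
      have "K \<subseteq> S" using 2 K by blast
      then have "dist (f b) (f a) \<le> C * dist b a"
        using ab by (intro lipschitz_onD[OF assms]) auto
      then show ?thesis using ab by (simp add: dist_norm)
    qed
    then have "(\<Sum>K\<in>\<D>. norm (f (Sup K) - f (Inf K))) \<le> C * (\<Sum>K\<in>\<D>. Sup K - Inf K)"
      by (simp add: sum_distrib_left sum_mono)
    also have "\<dots> \<le> C * (\<epsilon> / (C + 1))"
      using 2 C by (intro mult_left_mono) auto
    also have "\<dots> < \<epsilon>" using \<epsilon> C by (simp add: field_simps)
    finally show ?case .
  qed
qed

lemma lipschitz_on_cis: "1-lipschitz_on S cis"
proof (rule lipschitz_on_subset)
  show "1-lipschitz_on UNIV cis"
  proof (rule bounded_derivative_imp_lipschitz)
    fix t :: real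
    show "(cis has_derivative (\<lambda>s. s *\<^sub>R (\<i> * cis t))) (at t within UNIV)"
      using has_derivative_cis[OF has_derivative_ident] .
    show "onorm (\<lambda>s. s *\<^sub>R (\<i> * cis t)) \<le> 1"
      by (rule onorm_le) (simp add: norm_mult)
  qed auto
qed simp

lemma lipschitz_on_poly_cball:
  fixes p :: "complex poly"
  obtains C where "C-lipschitz_on (cball 0 R) (poly p)"
proof -
  have "bounded (poly (pderiv p) ` cball 0 R)"
    by (intro compact_imp_bounded compact_continuous_image continuous_intros) auto
  then obtain C where C: "C > 0" "\<And>z. z \<in> cball 0 R \<Longrightarrow> norm (poly (pderiv p) z) \<le> C"
    unfolding bounded_pos by blast
  have "dist (poly p x) (poly p y) \<le> C * dist x y" if "x \<in> cball 0 R" "y \<in> cball 0 R" for x y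
    unfolding dist_norm
    by (rule field_differentiable_bound[OF convex_cball[of 0 R], where f' = "poly (pderiv p)"])
      (use that C(2) in \<open>auto intro: has_field_derivative_at_within[OF poly_DERIV]\<close>)
  then have "C-lipschitz_on (cball 0 R) (poly p)"
    using C(1) by (intro lipschitz_onI) auto
  then show ?thesis by (rule that)
qed

text \<open>The disc is convex, so the bound makes \<open>\<phi>\<close> Lipschitz. A Lipschitz map
  extends to the closed disc with the same constant, and composing with \<open>cis\<close> and with
  a polynomial on a bounded set keeps it Lipschitz.\<close>

lemma poly_in_AC_if_deriv_bounded:
  fixes p :: "complex poly"
  assumes \<phi>: "conformal_map_of_disc \<phi> D"
    and M: "\<And>w. norm w < 1 \<Longrightarrow> norm (deriv \<phi> w) \<le> M"
  shows "poly p \<in> AC D"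
proof -
  have hol: "\<phi> holomorphic_on ball 0 1" using \<phi> by (simp add: conformal_map_of_disc_def)
  have "M \<ge> 0" using order_trans[OF norm_ge_zero M[of 0]] by simp
  moreover have "norm (\<phi> x - \<phi> y) \<le> M * norm (x - y)" if "x \<in> ball 0 1" "y \<in> ball 0 1" for x y
  proof (rule field_differentiable_bound[OF convex_ball[of 0 1], where f = \<phi> and f' = "deriv \<phi>"])
    fix z :: complex assume "z \<in> ball 0 1"
    then show "(\<phi> has_field_derivative deriv \<phi> z) (at z within ball 0 1)"
      by (rule has_field_derivative_at_within[OF holomorphic_derivI[OF hol open_ball]])
    show "norm (deriv \<phi> z) \<le> M" using M \<open>z \<in> ball 0 1\<close> by simp
  qed (use that in auto)
  ultimately have "M-lipschitz_on (ball 0 1) \<phi>"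
    by (intro lipschitz_onI) (auto simp: dist_norm)
  then obtain \<Phi> where \<Phi>: "M-lipschitz_on (cball 0 1) \<Phi>" "\<And>w. w \<in> ball 0 1 \<Longrightarrow> \<Phi> w = \<phi> w"
    using lipschitz_extend_closure[of M "ball 0 1" \<phi>] by auto
  have "bounded (\<Phi> ` cball 0 1)"
    by (intro compact_imp_bounded compact_continuous_image lipschitz_on_continuous_on[OF \<Phi>(1)]) auto
  then obtain R where R: "\<Phi> ` cball 0 1 \<subseteq> cball 0 R"
    using bounded_subset_ballD[of _ 0] ball_subset_cball by (meson subset_trans)
  obtain C where "C-lipschitz_on (cball 0 R) (poly p)"
    by (rule lipschitz_on_poly_cball)
  then have C: "C-lipschitz_on (\<Phi> ` cball 0 1) (poly p)"
    by (rule lipschitz_on_subset[OF _ R])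
  define g where "g = (\<lambda>w. poly p (\<Phi> w))"
  have g: "(C * M)-lipschitz_on (cball 0 1) g"
    unfolding g_def by (rule lipschitz_on_compose2[OF \<Phi>(1) C])
  have "(C * M * 1)-lipschitz_on {0..2 * pi} (\<lambda>t. g (cis t))"
    by (rule lipschitz_on_compose2[OF lipschitz_on_cis], rule lipschitz_on_subset[OF g]) auto
  then have "abs_continuous_on {0..2 * pi} (\<lambda>t. g (cis t))"
    by (rule lipschitz_imp_abs_continuous_on)
  moreover have "\<forall>w\<in>ball 0 1. g w = poly p (\<phi> w)" using \<Phi>(2) by (simp add: g_def)
  ultimately show ?thesis
    unfolding AC_def using \<phi> lipschitz_on_continuous_on[OF g]
    by (auto intro!: holomorphic_intros)
qed

text \<open>Multiplying the conformal map by \<open>c\<close> leaves the boundary function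
  \<open>g\<close> unchanged, so the same \<open>g\<close> witnesses both memberships.\<close>

lemma AC_poly_scale:
  fixes q :: "complex poly"
  assumes "c \<noteq> 0" "poly (pcompose q [:0, c:]) \<in> AC D"
  shows "poly q \<in> AC ((*) c ` D)"
proof -
  from assms(2) obtain \<phi> g where \<phi>: "conformal_map_of_disc \<phi> D"
    and g: "\<forall>w\<in>ball 0 1. g w = poly q (c * \<phi> w)" "continuous_on (cball 0 1) g"
      "abs_continuous_on {0..2 * pi} (\<lambda>t. g (cis t))"
    by (auto simp: AC_def poly_pcompose mult.commute)
  have "conformal_map_of_disc (\<lambda>w. c * \<phi> w) ((*) c ` D)"
    using \<phi> \<open>c \<noteq> 0\<close> unfolding conformal_map_of_disc_def
    by (auto intro!: holomorphic_intros simp: inj_on_def image_image)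
  with g show ?thesis
    unfolding AC_def by (auto intro!: holomorphic_intros)
qed

section \<open>Derivative estimates from exterior and interior discs\<close>

lemma conformal_deriv_le_dist_exterior_cball:
  assumes holf: "\<phi> holomorphic_on ball 0 1" and "r > 0"
    and dis: "\<phi> ` ball 0 1 \<inter> cball a r = {}" and w: "norm w < 1"
  shows "norm (deriv \<phi> w) * (1 - norm w) \<le> ((dist a (\<phi> w))\<^sup>2 - r\<^sup>2) / r"
proof -
  \<comment> \<open>Up to translation and conjugation this is inversion in the circle bounding
    \<open>cball a r\<close>; it sends the image of \<open>\<phi>\<close> into the unit
    disc.\<close>
  define h where "h = (\<lambda>w. of_real r / (\<phi> w - a))"
  have far: "r < norm (\<phi> w - a)" if "norm w < 1" for w
    using dis that by (force simp: dist_norm norm_minus_commute)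
  have nz: "\<phi> w - a \<noteq> 0" if "norm w < 1" for w
    using far[OF that] \<open>r > 0\<close> by auto
  have "h holomorphic_on ball 0 1"
    unfolding h_def by (intro holomorphic_intros holf) (use nz in auto)
  moreover have "norm (h z) < 1" if "norm z < 1" for z
    using far[OF that] \<open>r > 0\<close> nz[OF that] by (simp add: h_def norm_divide divide_simps)
  ultimately have "norm (deriv h w) * (1 - (norm w)\<^sup>2) \<le> 1 - (norm (h w))\<^sup>2"
    using w by (rule Schwarz_Pick_deriv)
  moreover have "deriv h w = - (of_real r * deriv \<phi> w) / (\<phi> w - a)\<^sup>2"
  proof (rule DERIV_imp_deriv)
    have "(\<phi> has_field_derivative deriv \<phi> w) (at w)"
      using holf w by (intro holomorphic_derivI[of _ "ball 0 1"]) auto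
    then show "(h has_field_derivative - (of_real r * deriv \<phi> w) / (\<phi> w - a)\<^sup>2) (at w)"
      unfolding h_def using nz[OF w]
      by (auto intro!: derivative_eq_intros simp: power2_eq_square)
  qed
  moreover define R where "R = norm (\<phi> w - a)"
  have R: "r < R" using far[OF w] by (simp add: R_def)
  ultimately have "r * norm (deriv \<phi> w) / R\<^sup>2 * (1 - (norm w)\<^sup>2) \<le> 1 - (r / R)\<^sup>2"
    using \<open>r > 0\<close> by (simp add: h_def R_def norm_divide norm_mult norm_power)
  also have "1 - (r / R)\<^sup>2 = (R\<^sup>2 - r\<^sup>2) / R\<^sup>2"
    using R \<open>r > 0\<close> by (simp add: power_divide diff_divide_distrib)
  finally have "r * (norm (deriv \<phi> w) * (1 - (norm w)\<^sup>2)) \<le> R\<^sup>2 - r\<^sup>2"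
    using R \<open>r > 0\<close> by (simp add: divide_le_cancel mult.assoc)
  then have "norm (deriv \<phi> w) * (1 - (norm w)\<^sup>2) \<le> (R\<^sup>2 - r\<^sup>2) / r"
    using \<open>r > 0\<close> by (simp add: field_simps)
  moreover have "norm (deriv \<phi> w) * (1 - norm w) \<le> norm (deriv \<phi> w) * (1 - (norm w)\<^sup>2)"
    using w by (intro mult_left_mono) (auto simp: power2_eq_square mult_left_le)
  ultimately show ?thesis by (simp add: R_def dist_norm norm_minus_commute)
qed

text \<open>\<open>Schwarz_Pick_centre\<close> on the rescaled ball. As
  \<open>1 - dist a z / \<rho>\<close> is the relative depth of \<open>z\<close> in the ball, this
  bounds the depth by a multiple of \<open>1 - norm (\<psi> z)\<close>.\<close>

lemma conformal_inverse_interior_ball: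
  assumes hol: "\<psi> holomorphic_on D" and im: "\<psi> ` D \<subseteq> ball 0 1"
    and D: "ball a \<rho> \<subseteq> D" "z \<in> ball a \<rho>"
  shows "(1 - dist a z / \<rho>) * (1 - norm (\<psi> a)) \<le> 4 * (1 - norm (\<psi> z))"
proof -
  have \<rho>: "\<rho> > 0" using D(2) by (auto intro: le_less_trans[OF zero_le_dist])
  define f where "f = (\<lambda>u. \<psi> (a + of_real \<rho> * u))"
  have inb: "a + of_real \<rho> * u \<in> D" if "norm u < 1" for u
    using that \<rho> D(1) by (auto simp: dist_norm norm_mult subset_iff)
  have "f holomorphic_on ball 0 1"
    unfolding f_def
    by (rule holomorphic_on_compose_gen[OF _ hol, unfolded o_def])
      (use inb in \<open>auto intro!: holomorphic_intros\<close>)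
  moreover have "norm (f u) < 1" if "norm u < 1" for u
    using inb[OF that] im by (auto simp: f_def)
  moreover define w where "w = (z - a) / of_real \<rho>"
  have "norm w = dist a z / \<rho>"
    using \<rho> by (simp add: w_def norm_divide dist_norm norm_minus_commute)
  moreover have "dist a z / \<rho> < 1" using D(2) \<rho> by simp
  ultimately have "(1 - norm w) * (1 - norm (f 0)) \<le> 4 * (1 - norm (f w))"
    by (intro Schwarz_Pick_centre) auto
  moreover have "f w = \<psi> z" using \<rho> by (simp add: f_def w_def)
  ultimately show ?thesis by (simp add: f_def \<open>norm w = dist a z / \<rho>\<close>)
qed

text \<open>The interior centres are confined to the compact set \<open>K\<close> so that
  \<open>norm (\<psi> a)\<close> stays below one \<open>s < 1\<close>, which makes the interior
  estimate uniform. On \<open>K\<close> itself continuity of the derivative is enough.\<close>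

lemma conformal_deriv_bounded:
  assumes \<phi>: "conformal_map_of_disc \<phi> D" and "bounded D"
    and K: "compact K" "K \<subseteq> D" and r: "r > 0" and C: "C \<ge> 0"
    and near: "\<And>z. z \<in> D - K \<Longrightarrow> \<exists>\<delta>>0. (\<exists>a\<in>K. ball a (dist a z + \<delta>) \<subseteq> D) \<and>
      (\<exists>a. dist a z \<le> r + C * \<delta> \<and> D \<inter> cball a r = {})"
  obtains M where "\<And>w. norm w < 1 \<Longrightarrow> norm (deriv \<phi> w) \<le> M"
proof -
  have hol: "\<phi> holomorphic_on ball 0 1" and inj: "inj_on \<phi> (ball 0 1)" and im: "\<phi> ` ball 0 1 = D"
    using \<phi> by (auto simp: conformal_map_of_disc_def)
  obtain \<psi> where hol\<psi>: "\<psi> holomorphic_on D" and \<psi>: "\<And>w. w \<in> ball 0 1 \<Longrightarrow> \<psi> (\<phi> w) = w"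
    using holomorphic_has_inverse[OF hol open_ball inj] im by metis
  have im\<psi>: "\<psi> ` D \<subseteq> ball 0 1" using \<psi> im by force
  have cont: "continuous_on K \<psi>"
    using holomorphic_on_imp_continuous_on[OF hol\<psi>] K(2) continuous_on_subset by blast
  then have cK: "compact (\<psi> ` K)" using K(1) by (rule compact_continuous_image)
  have "\<exists>s<1. \<forall>a\<in>K. norm (\<psi> a) \<le> s"
  proof (cases "K = {}")
    case False
    have "continuous_on K (\<lambda>a. norm (\<psi> a))" by (intro continuous_intros cont)
    from continuous_attains_sup[OF K(1) False this] obtain a where
      "a \<in> K" "\<forall>y\<in>K. norm (\<psi> y) \<le> norm (\<psi> a)" by auto
    moreover have "norm (\<psi> a) < 1" using im\<psi> K(2) \<open>a \<in> K\<close> by force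
    ultimately show ?thesis by blast
  qed (auto intro: exI[of _ 0])
  then obtain s where s: "s < 1" "\<And>a. a \<in> K \<Longrightarrow> norm (\<psi> a) \<le> s" by blast
  have "bounded (deriv \<phi> ` (\<psi> ` K))"
  proof (intro compact_imp_bounded compact_continuous_image[OF _ cK])
    have "continuous_on (ball 0 1) (deriv \<phi>)"
      by (intro holomorphic_on_imp_continuous_on holomorphic_deriv hol) auto
    then show "continuous_on (\<psi> ` K) (deriv \<phi>)"
      by (rule continuous_on_subset) (use im\<psi> K(2) in blast)
  qed
  then obtain M1 where M1: "\<forall>y\<in>deriv \<phi> ` \<psi> ` K. norm y \<le> M1"
    unfolding bounded_iff by (elim exE)
  obtain B where B: "D \<subseteq> cball 0 B" using bounded_subset_ballD[OF \<open>bounded D\<close>, of 0] ball_subset_cball subset_trans by metis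
  \<comment> \<open>\<open>N\<close> comes from
    \<open>\<delta> / B * (1 - s) \<le> 4 * (1 - norm w)\<close>. \<open>M2\<close> comes from
    \<open>(r + C \<delta>)^2 - r^2 = C \<delta> (2 r + C \<delta>)\<close>, with
    \<open>\<delta>\<close> bounded by \<open>N (1 - norm w)\<close> in the first factor and by
    \<open>B\<close> in the second.\<close>
  define N where "N = 4 * B / (1 - s)"
  define M2 where "M2 = C * N * (2 * r + C * B) / r"
  have "norm (deriv \<phi> w) \<le> max M1 M2" if w: "norm w < 1" for w
  proof (cases "\<phi> w \<in> K")
    case True
    then have "w \<in> \<psi> ` K" using \<psi>[of w] w by force
    then have "norm (deriv \<phi> w) \<le> M1" using M1 by blast
    then show ?thesis by simp
  next
    case False
    define z where "z = \<phi> w"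
    have z: "z \<in> D - K" and \<psi>z: "\<psi> z = w" using False im w \<psi> by (auto simp: z_def)
    from near[OF z] obtain \<delta> a a' where \<delta>: "\<delta> > 0" and a: "a \<in> K" "ball a (dist a z + \<delta>) \<subseteq> D"
      and a': "dist a' z \<le> r + C * \<delta>" "D \<inter> cball a' r = {}" by blast
    define \<rho> where "\<rho> = dist a z + \<delta>"
    have \<rho>: "\<rho> > 0" using \<delta> by (simp add: \<rho>_def add_nonneg_pos)
    have "ball a \<rho> \<subseteq> cball 0 B" using a(2) B by (auto simp: \<rho>_def)
    then have "dist a 0 + \<rho> \<le> B" using \<rho> by (simp add: ball_subset_cball_iff)
    then have \<rho>B: "\<rho> \<le> B" using zero_le_dist[of a 0] by linarith
    have \<delta>B: "\<delta> \<le> B" using \<rho>B zero_le_dist[of a z] unfolding \<rho>_def by linarith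
    have B0: "B > 0" using \<rho> \<rho>B by linarith
    have "\<delta> / B * (1 - s) \<le> (1 - dist a z / \<rho>) * (1 - norm (\<psi> a))"
    proof (intro mult_mono)
      have "1 - dist a z / \<rho> = \<delta> / \<rho>" using \<rho> by (simp add: \<rho>_def field_simps)
      then show "\<delta> / B \<le> 1 - dist a z / \<rho>" using \<rho>B \<rho> \<delta> by (simp add: frac_le)
      then show "0 \<le> 1 - dist a z / \<rho>" using \<delta> B0 by (smt (verit) divide_pos_pos)
    qed (use s a(1) in auto)
    also have "\<dots> \<le> 4 * (1 - norm (\<psi> z))"
      by (rule conformal_inverse_interior_ball[OF hol\<psi> im\<psi>]) (use a(2) \<delta> in \<open>auto simp: \<rho>_def\<close>)
    finally have \<delta>N: "\<delta> \<le> N * (1 - norm w)"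
      using B0 s(1) by (simp add: \<psi>z N_def field_simps)
    have "norm (deriv \<phi> w) * (1 - norm w) \<le> ((dist a' z)\<^sup>2 - r\<^sup>2) / r"
      unfolding z_def
      by (rule conformal_deriv_le_dist_exterior_cball[OF hol r]) (use a' im w in auto)
    also have "\<dots> \<le> ((r + C * \<delta>)\<^sup>2 - r\<^sup>2) / r"
      using a'(1) r by (intro divide_right_mono diff_right_mono power_mono) auto
    also have "\<dots> = C * \<delta> * (2 * r + C * \<delta>) / r"
      by (simp add: power2_eq_square algebra_simps)
    also have "\<dots> \<le> C * (N * (1 - norm w)) * (2 * r + C * B) / r"
      using \<delta>N \<delta>B \<delta> C r w B0 s(1) by (intro divide_right_mono mult_mono add_mono mult_nonneg_nonneg)
        (auto simp: N_def)
    also have "\<dots> = M2 * (1 - norm w)" by (simp add: M2_def)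
    finally have "norm (deriv \<phi> w) \<le> M2" using w by simp
    then show ?thesis by simp
  qed
  then show ?thesis by (rule that)
qed

section \<open>Ovals of positive definite biquadratic forms\<close>

text \<open>In \<open>X = x^2\<close> and \<open>Y = y^2\<close> the quartic is the quadratic form
  \<open>A X^2 - 2 C X Y + B Y^2\<close>; \<open>disc\<close> together with \<open>A_pos\<close> is
  its positive definiteness.\<close>

locale quartic_oval =
  fixes A B C :: real
  assumes A_pos: "A > 0" and B_pos: "B > 0" and disc: "C\<^sup>2 < A * B"
begin

section \<open>The form \<open>H\<close> and its sublevel sets\<close>

definition H :: "complex \<Rightarrow> real" where
  "H z = A * Re z ^ 4 - 2 * C * (Re z)\<^sup>2 * (Im z)\<^sup>2 + B * Im z ^ 4"

definition H_grad :: "complex \<Rightarrow> complex" where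
  "H_grad z = Complex (4 * A * Re z ^ 3 - 4 * C * Re z * (Im z)\<^sup>2)
                      (4 * B * Im z ^ 3 - 4 * C * (Re z)\<^sup>2 * Im z)"

definition oval :: "complex set" where "oval = {z. H z < 1}"

definition level_curve :: "complex set" where "level_curve = {z. H z = 1}"

lemma continuous_on_H [continuous_intros]: "continuous_on S H"
  unfolding H_def by (intro continuous_intros)

lemma H_of_real_mult: "H (of_real t * z) = t ^ 4 * H z"
  by (simp add: H_def algebra_simps power_mult_distrib)

lemma H_zero [simp]: "H 0 = 0"
  by (simp add: H_def)

lemma H_pos: "z \<noteq> 0 \<Longrightarrow> H z > 0"
proof -
  assume z: "z \<noteq> 0"
  have eq: "A * H z = (A * (Re z)\<^sup>2 - C * (Im z)\<^sup>2)\<^sup>2 + (A * B - C\<^sup>2) * ((Im z)\<^sup>2)\<^sup>2"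
    by (simp add: H_def power2_eq_square power4_eq_xxxx algebra_simps)
  have "A * H z > 0"
  proof (cases "Im z = 0")
    case True
    then have "Re z \<noteq> 0" using z by (simp add: complex_eq_iff)
    then show ?thesis unfolding eq using True A_pos by simp
  next
    case False
    then show ?thesis unfolding eq using disc by (intro add_nonneg_pos mult_pos_pos) auto
  qed
  then show ?thesis using A_pos by (simp add: zero_less_mult_iff)
qed

lemma H_lower_bound:
  obtains c where "c > 0" "\<And>z. c * norm z ^ 4 \<le> H z"
proof -
  have "\<exists>x\<in>sphere (0::complex) 1. \<forall>y\<in>sphere 0 1. H x \<le> H y"
    by (intro continuous_attains_inf continuous_intros) auto
  then obtain x where x: "norm x = 1" "\<And>y. norm y = 1 \<Longrightarrow> H x \<le> H y" by auto
  have "H x * norm z ^ 4 \<le> H z" for z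
  proof (cases "z = 0")
    case False
    have "H x \<le> H (of_real (inverse (norm z)) * z)"
      using False by (intro x(2)) (simp add: norm_mult norm_inverse)
    then show ?thesis
      unfolding H_of_real_mult using False by (simp add: field_simps)
  qed simp
  moreover have "H x > 0" using x(1) by (intro H_pos) auto
  ultimately show ?thesis by (intro that)
qed

lemma H_le_one_bound:
  obtains R where "R \<ge> 1" "\<And>z. H z \<le> 1 \<Longrightarrow> norm z \<le> R"
proof -
  obtain c where c: "c > 0" "\<And>z. c * norm z ^ 4 \<le> H z" using H_lower_bound by blast
  define R where "R = max 1 (1 / c)"
  have R: "R \<ge> 1" "R \<ge> 1 / c" by (auto simp: R_def)
  have "norm z \<le> R" if "H z \<le> 1" for z
  proof (rule ccontr)
    assume "\<not> norm z \<le> R"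
    then have "norm z \<ge> 1" "norm z > 1 / c" using R by auto
    then have "norm z ^ 4 > 1 / c"
      using power_increasing[of 1 4 "norm z"] by simp
    then have "c * norm z ^ 4 > 1" using c(1) by (simp add: field_simps)
    then show False using c(2)[of z] that by simp
  qed
  with R(1) show ?thesis by (rule that)
qed

lemma open_oval: "open oval"
proof -
  have "open (H -` {..<1})"
    by (intro open_vimage continuous_intros open_lessThan)
  then show ?thesis by (simp add: oval_def vimage_def)
qed

lemma closed_sublevel: "closed {z. H z \<le> a}"
  by (intro closed_Collect_le continuous_intros)

lemma compact_sublevel:
  assumes "a \<le> 1"
  shows "compact {z. H z \<le> a}"
proof -
  obtain R where "\<And>z. H z \<le> 1 \<Longrightarrow> norm z \<le> R" using H_le_one_bound by blast
  then have "bounded {z. H z \<le> a}"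
    using assms by (intro boundedI[of _ R]) auto
  then show ?thesis by (simp add: compact_eq_bounded_closed closed_sublevel)
qed

lemma bounded_oval: "bounded oval"
proof (rule bounded_subset)
  show "bounded {z. H z \<le> 1}" by (intro compact_imp_bounded compact_sublevel) simp
qed (auto simp: oval_def)

lemma zero_in_oval [simp]: "0 \<in> oval"
  by (simp add: oval_def)

lemma scale_in_oval:
  assumes "H z \<le> 1" "0 \<le> t" "t < 1"
  shows "of_real t * z \<in> oval"
proof -
  have "t ^ 4 < 1" using assms(2,3) by (simp add: power_less_one_iff)
  moreover have "t ^ 4 * H z \<le> t ^ 4" using assms by (simp add: mult_left_le)
  ultimately show ?thesis by (simp add: oval_def H_of_real_mult)
qed

lemma starlike_oval: "starlike oval"
  unfolding starlike_def
proof (intro bexI[of _ 0] ballI subsetI)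
  fix z w assume z: "z \<in> oval" and w: "w \<in> closed_segment 0 z"
  then obtain u where u: "0 \<le> u" "u \<le> 1" "w = of_real u * z"
    by (auto simp: closed_segment_def scaleR_conv_of_real)
  then show "w \<in> oval"
    using z scale_in_oval[of z u] by (cases "u = 1") (auto simp: oval_def)
qed simp

section \<open>Second-order expansion of \<open>H\<close> and discs on both sides of the level
  curve\<close>

lemma H_taylor:
  assumes R: "R \<ge> 1" and z: "norm z \<le> R" and h: "norm h \<le> 1"
  shows "\<bar>H (z + h) - H z - H_grad z \<bullet> h\<bar> \<le> 11 * R\<^sup>2 * (A + 2 * \<bar>C\<bar> + B) * (norm h)\<^sup>2"
proof -
  define x y p q n where "x = Re z" "y = Im z" "p = Re h" "q = Im h" "n = norm h"
  note defs = this
  have n: "0 \<le> n" "n \<le> 1" using h by (auto simp: defs)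
  have x: "\<bar>x\<bar> \<le> R" "\<bar>y\<bar> \<le> R" "\<bar>p\<bar> \<le> n" "\<bar>q\<bar> \<le> n"
    using z abs_Re_le_cmod[of z] abs_Im_le_cmod[of z] abs_Re_le_cmod[of h] abs_Im_le_cmod[of h]
    by (auto simp: defs)
  \<comment> \<open>Each monomial of the remainder is a product of two factors bounded in
    \<open>lin\<close> or \<open>sq\<close> by \<open>R n\<close> (as \<open>R \<ge> 1\<close> and
    \<open>n \<le> 1\<close>), hence is at most \<open>k\<close>. In each group the coefficients add
    up to 11: 6 + 4 + 1, and 1 + 1 + 4 + 2 + 2 + 1.\<close>
  define k where "k = (R * n)\<^sup>2"
  have lin: "\<bar>x * p\<bar> \<le> R * n" "\<bar>x * q\<bar> \<le> R * n" "\<bar>y * p\<bar> \<le> R * n" "\<bar>y * q\<bar> \<le> R * n"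
    using x R n unfolding abs_mult by (auto intro!: mult_mono)
  have sq: "\<bar>p * p\<bar> \<le> R * n" "\<bar>q * q\<bar> \<le> R * n"
  proof -
    have "\<bar>a * a\<bar> \<le> R * n" if "\<bar>a\<bar> \<le> n" for a
      using that R n unfolding abs_mult by (intro mult_mono) auto
    then show "\<bar>p * p\<bar> \<le> R * n" "\<bar>q * q\<bar> \<le> R * n" using x by auto
  qed
  have prod: "\<bar>a * b\<bar> \<le> k" if "\<bar>a\<bar> \<le> R * n" "\<bar>b\<bar> \<le> R * n" for a b
    using that R n unfolding k_def power2_eq_square abs_mult by (intro mult_mono) auto
  have Ax: "\<bar>6 * ((x * p) * (x * p)) + 4 * ((x * p) * (p * p)) + (p * p) * (p * p)\<bar> \<le> 11 * k"
    using prod[OF lin(1) lin(1)] prod[OF lin(1) sq(1)] prod[OF sq(1) sq(1)] by linarith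
  have By: "\<bar>6 * ((y * q) * (y * q)) + 4 * ((y * q) * (q * q)) + (q * q) * (q * q)\<bar> \<le> 11 * k"
    using prod[OF lin(4) lin(4)] prod[OF lin(4) sq(2)] prod[OF sq(2) sq(2)] by linarith
  have Cxy: "\<bar>(x * q) * (x * q) + (y * p) * (y * p) + 4 * ((x * p) * (y * q))
      + 2 * ((x * p) * (q * q)) + 2 * ((y * q) * (p * p)) + (p * p) * (q * q)\<bar> \<le> 11 * k"
    using prod[OF lin(2) lin(2)] prod[OF lin(3) lin(3)] prod[OF lin(1) lin(4)]
      prod[OF lin(1) sq(2)] prod[OF lin(4) sq(1)] prod[OF sq(1) sq(2)] by linarith
  have "H (z + h) - H z - H_grad z \<bullet> h
    = A * (6 * ((x * p) * (x * p)) + 4 * ((x * p) * (p * p)) + (p * p) * (p * p))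
    - 2 * C * ((x * q) * (x * q) + (y * p) * (y * p) + 4 * ((x * p) * (y * q))
      + 2 * ((x * p) * (q * q)) + 2 * ((y * q) * (p * p)) + (p * p) * (q * q))
    + B * (6 * ((y * q) * (y * q)) + 4 * ((y * q) * (q * q)) + (q * q) * (q * q))"
    (is "_ = A * ?a - 2 * C * ?c + B * ?b")
    unfolding H_def H_grad_def inner_complex_def defs
    by (simp add: power2_eq_square power3_eq_cube power4_eq_xxxx algebra_simps)
  moreover have "\<bar>A * ?a\<bar> \<le> A * (11 * k)" "\<bar>B * ?b\<bar> \<le> B * (11 * k)"
    "\<bar>2 * C * ?c\<bar> \<le> 2 * \<bar>C\<bar> * (11 * k)"
    using mult_left_mono[OF Ax, of A] mult_left_mono[OF By, of B]
      mult_left_mono[OF Cxy, of "2 * \<bar>C\<bar>"] A_pos B_pos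
    by (simp_all add: abs_mult)
  ultimately have "\<bar>H (z + h) - H z - H_grad z \<bullet> h\<bar> \<le> A * (11 * k) + 2 * \<bar>C\<bar> * (11 * k) + B * (11 * k)"
    by linarith
  also have "\<dots> = 11 * R\<^sup>2 * (A + 2 * \<bar>C\<bar> + B) * (norm h)\<^sup>2"
    by (simp add: k_def defs power_mult_distrib algebra_simps)
  finally show ?thesis .
qed

text \<open>Euler's relation in degree 4; it keeps the gradient away from 0 near the level
  \<open>H = 1\<close>.\<close>

lemma H_grad_euler: "H_grad z \<bullet> z = 4 * H z"
  by (simp add: H_grad_def H_def inner_complex_def power2_eq_square power3_eq_cube
      power4_eq_xxxx algebra_simps)

text \<open>For \<open>z\<close> in a thin shell inside the curve with unit gradient
  \<open>n\<close>, the centres are \<open>z - r n\<close> and \<open>z + (r + \<rho>) n\<close>.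
  Balls of small radius stay on one side because their own curvature dominates the second-order term
  \<open>M * (norm h)^2\<close>.\<close>

lemma near_boundary_balls:
  obtains K r c where "compact K" "K \<subseteq> oval" "r > 0" "c \<ge> 0"
    "\<And>z. z \<in> oval - K \<Longrightarrow> \<exists>\<delta>>0. (\<exists>a\<in>K. ball a (dist a z + \<delta>) \<subseteq> oval) \<and>
      (\<exists>a. dist a z \<le> r + c * \<delta> \<and> oval \<inter> cball a r = {})"
proof -
  obtain R where R: "R \<ge> 1" "\<And>z. H z \<le> 1 \<Longrightarrow> norm z \<le> R" using H_le_one_bound by blast
  define M where "M = 11 * R\<^sup>2 * (A + 2 * \<bar>C\<bar> + B)"
  have M: "M > 0" using R A_pos B_pos by (simp add: M_def add_pos_nonneg)
  \<comment> \<open>Lower bound for the gradient in the shell: where \<open>H z \<ge> 1/2\<close>,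
    Euler's relation gives \<open>H_grad z \<bullet> z \<ge> 2\<close>, while
    \<open>norm z \<le> R\<close>.\<close>
  define \<kappa> where "\<kappa> = 2 / R"
  have \<kappa>: "\<kappa> > 0" using R by (simp add: \<kappa>_def)
  have "bounded (H_grad ` {z. H z \<le> 1})"
    unfolding H_grad_def
    by (intro compact_imp_bounded compact_continuous_image compact_sublevel continuous_intros) simp
  then obtain G0 where "\<forall>u\<in>H_grad ` {z. H z \<le> 1}. norm u \<le> G0"
    unfolding bounded_iff by (elim exE)
  then have G0: "norm (H_grad z) \<le> G0" if "H z \<le> 1" for z using that by blast
  define G where "G = max \<kappa> G0"
  have G: "G \<ge> \<kappa>" "\<And>z. H z \<le> 1 \<Longrightarrow> norm (H_grad z) \<le> G"
    using G0 by (fastforce simp: G_def)+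
  have G_pos: "G > 0" using G(1) \<kappa> by linarith
  \<comment> \<open>Displacements \<open>h\<close> reach norm at most \<open>3 r\<close>, so
    \<open>1/4\<close> keeps them within the range of \<open>H_taylor\<close>. The bound
    \<open>\<kappa> / (4 * M)\<close> lets curvature beat the Taylor remainder; the outer ball needs
    the factor 4, its centre being up to \<open>2 r\<close> away.\<close>
  define r where "r = min (1/4) (\<kappa> / (4 * M))"
  have r: "r > 0" "r \<le> 1/4" "4 * M * r \<le> \<kappa>"
    using \<kappa> M by (auto simp: r_def min_def field_simps)
  \<comment> \<open>\<open>1/2\<close> serves the gradient bound \<open>\<kappa>\<close>;
    \<open>\<kappa> * r / 2\<close> puts the interior centre into \<open>K\<close> and gives
    \<open>\<rho> \<le> r\<close>.\<close>
  define \<eta> where "\<eta> = min (1/2) (\<kappa> * r / 2)"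
  have \<eta>: "\<eta> > 0" "\<eta> \<le> 1/2" "\<eta> \<le> \<kappa> * r / 2"
    using r \<kappa> by (auto simp: \<eta>_def)
  define K where "K = {z. H z \<le> 1 - \<eta>}"
  define c where "c = 4 * G / \<kappa>"
  have near: "\<exists>\<delta>>0. (\<exists>a\<in>K. ball a (dist a z + \<delta>) \<subseteq> oval) \<and>
      (\<exists>a. dist a z \<le> r + c * \<delta> \<and> oval \<inter> cball a r = {})" if z: "z \<in> oval - K" for z
  proof -
    have Hz: "H z < 1" "H z > 1 - \<eta>" using z by (auto simp: oval_def K_def)
    have zR: "norm z \<le> R" using R(2) Hz(1) by simp
    define g where "g = norm (H_grad z)"
    have "2 \<le> H_grad z \<bullet> z" using Hz(2) \<eta>(2) by (simp add: H_grad_euler)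
    also have "\<dots> \<le> g * norm z" unfolding g_def by (rule norm_cauchy_schwarz)
    also have "\<dots> \<le> g * R" using zR by (simp add: g_def mult_left_mono)
    finally have g\<kappa>: "\<kappa> \<le> g" using R(1) by (simp add: \<kappa>_def field_simps)
    have gG: "g \<le> G" using G(2) Hz(1) by (simp add: g_def)
    have g_pos: "g > 0" using g\<kappa> \<kappa> by linarith
    define n where "n = H_grad z /\<^sub>R g"
    have n1: "norm n = 1" using g_pos by (simp add: n_def g_def)
    have nn: "n \<bullet> n = 1" using n1 by (simp add: dot_square_norm)
    have grad: "H_grad z \<bullet> h = g * (h \<bullet> n)" for h
      using g_pos by (simp add: n_def inner_commute)
    have upper: "H (z + h) \<le> H z + g * (h \<bullet> n) + M * (norm h)\<^sup>2"
      and lower: "H (z + h) \<ge> H z + g * (h \<bullet> n) - M * (norm h)\<^sup>2" if "norm h \<le> 1" for h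
      using H_taylor[OF R(1) zR that] by (simp_all add: grad M_def)
    define \<epsilon> where "\<epsilon> = 1 - H z"
    have \<epsilon>: "\<epsilon> > 0" "\<epsilon> \<le> \<eta>" using Hz by (auto simp: \<epsilon>_def)
    \<comment> \<open>The gap \<open>\<epsilon>\<close> to level 1 becomes a length through the
      gradient bounds: \<open>2 * G * \<delta> = \<epsilon>\<close> inside and
      \<open>\<kappa> * \<rho> = 2 * \<epsilon>\<close> outside; \<open>c\<close> is the ratio
      \<open>\<rho> / \<delta>\<close>.\<close>
    define \<delta> where "\<delta> = \<epsilon> / (2 * G)"
    have \<delta>: "\<delta> > 0" using \<epsilon> G_pos by (simp add: \<delta>_def)
    define \<rho> where "\<rho> = 2 * \<epsilon> / \<kappa>"
    have \<rho>: "\<rho> > 0" using \<epsilon> \<kappa> by (simp add: \<rho>_def)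
    have \<rho>r: "\<rho> \<le> r"
      using \<epsilon>(2) \<eta>(3) \<kappa> by (simp add: \<rho>_def pos_divide_le_eq algebra_simps)
    have \<rho>\<delta>: "\<rho> = c * \<delta>" using \<kappa> G_pos by (simp add: \<rho>_def c_def \<delta>_def)
    have \<delta>r: "\<delta> \<le> r"
    proof -
      have "\<delta> \<le> \<epsilon> / (2 * \<kappa>)" unfolding \<delta>_def using G(1) \<kappa> \<epsilon> by (intro divide_left_mono) auto
      also have "\<dots> \<le> \<rho>" using \<kappa> \<epsilon> by (simp add: \<rho>_def field_simps)
      finally show ?thesis using \<rho>r by simp
    qed
    define a where "a = z - r *\<^sub>R n"
    have "norm (- r *\<^sub>R n) \<le> 1" using r n1 by simp
    from upper[OF this] have "H a \<le> H z - g * r + M * r\<^sup>2"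
      using r n1 nn by (simp add: a_def)
    also have "\<dots> \<le> 1 - \<kappa> * r + \<kappa> * r / 4"
    proof -
      have "\<kappa> * r \<le> g * r" using g\<kappa> r by (intro mult_right_mono) auto
      moreover have "4 * M * r * r \<le> \<kappa> * r" using r by (intro mult_right_mono) auto
      ultimately show ?thesis using Hz(1) by (simp add: power2_eq_square algebra_simps)
    qed
    also have "\<dots> \<le> 1 - \<eta>" using \<eta>(3) mult_pos_pos[OF \<kappa> r(1)] by simp
    finally have "a \<in> K" by (simp add: K_def)
    have daz: "dist a z = r" using r n1 by (simp add: a_def dist_norm)
    have "ball a (dist a z + \<delta>) \<subseteq> oval"
    proof
      fix u assume "u \<in> ball a (dist a z + \<delta>)"
      then have u: "norm (u - a) < r + \<delta>"
        unfolding daz by (simp add: dist_norm norm_minus_commute)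
      define h where "h = u - z"
      have ua: "u - a = h + r *\<^sub>R n" by (simp add: h_def a_def)
      have "norm h \<le> norm (u - a) + norm (r *\<^sub>R n)"
        using norm_triangle_ineq4[of "u - a" "r *\<^sub>R n"] by (simp add: ua)
      then have h1: "norm h \<le> 1" using u n1 r \<delta>r by simp
      have "(norm (u - a))\<^sup>2 < (r + \<delta>)\<^sup>2" using u by (intro power_strict_mono) auto
      moreover have "(norm (u - a))\<^sup>2 = (norm h)\<^sup>2 + 2 * r * (h \<bullet> n) + r\<^sup>2"
        unfolding ua power2_norm_eq_inner
        by (simp add: inner_add_left inner_add_right nn inner_commute power2_eq_square)
      \<comment> \<open>The leftover \<open>- (norm h)^2\<close> of the ball condition absorbs the
        Taylor remainder, since \<open>2 * r * M \<le> g\<close>.\<close>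
      ultimately have "2 * r * (h \<bullet> n) < 2 * r * \<delta> + \<delta>\<^sup>2 - (norm h)\<^sup>2"
        by (simp add: power2_eq_square algebra_simps)
      then have "g * (2 * r * (h \<bullet> n)) < g * (2 * r * \<delta> + \<delta>\<^sup>2 - (norm h)\<^sup>2)"
        using g_pos by simp
      moreover have "2 * r * (M * (norm h)\<^sup>2) \<le> g * (norm h)\<^sup>2"
      proof -
        have "2 * r * M \<le> g" using r(3) g\<kappa> mult_pos_pos[OF M r(1)] by (simp add: algebra_simps)
        then have "(2 * r * M) * (norm h)\<^sup>2 \<le> g * (norm h)\<^sup>2" by (intro mult_right_mono) auto
        then show ?thesis by (simp add: algebra_simps)
      qed
      moreover have "g * \<delta>\<^sup>2 \<le> g * (2 * r * \<delta>)"
        using g_pos \<delta> \<delta>r by (intro mult_left_mono) (auto simp: power2_eq_square)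
      ultimately have "2 * r * (g * (h \<bullet> n) + M * (norm h)\<^sup>2) < 2 * r * (2 * g * \<delta>)"
        by (simp add: algebra_simps)
      then have "g * (h \<bullet> n) + M * (norm h)\<^sup>2 < 2 * g * \<delta>" using r(1) by simp
      also have "\<dots> \<le> 2 * G * \<delta>" using gG \<delta> by (intro mult_right_mono) auto
      also have "\<dots> = \<epsilon>" using G_pos by (simp add: \<delta>_def)
      finally have "H (z + h) < 1" using upper[OF h1] by (simp add: \<epsilon>_def)
      then show "u \<in> oval" by (simp add: oval_def h_def)
    qed
    define a' where "a' = z + (r + \<rho>) *\<^sub>R n"
    have "dist a' z = r + c * \<delta>" using r \<rho> n1 by (simp add: a'_def dist_norm \<rho>\<delta>[symmetric])
    moreover have "oval \<inter> cball a' r = {}"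
    proof -
      have "H u \<ge> 1" if "u \<in> cball a' r" for u
      proof -
        have u: "norm (u - a') \<le> r" using that by (simp add: dist_norm norm_minus_commute)
        define h where "h = u - z"
        define s where "s = r + \<rho>"
        have s: "s > 0" "s \<le> 2 * r" using r \<rho> \<rho>r by (auto simp: s_def)
        have ua: "u - a' = h - s *\<^sub>R n" by (simp add: h_def a'_def s_def)
        have "norm h \<le> norm (u - a') + norm (s *\<^sub>R n)"
          using norm_triangle_ineq[of "u - a'" "s *\<^sub>R n"] by (simp add: ua)
        then have h1: "norm h \<le> 1" using u n1 r s by simp
        have "(norm (u - a'))\<^sup>2 \<le> r\<^sup>2" using u by (intro power_mono) auto
        moreover have "(norm (u - a'))\<^sup>2 = (norm h)\<^sup>2 - 2 * s * (h \<bullet> n) + s\<^sup>2"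
          unfolding ua power2_norm_eq_inner
          by (simp add: inner_diff_left inner_diff_right nn inner_commute power2_eq_square)
        moreover have "s\<^sup>2 - r\<^sup>2 = \<rho> * (r + s)"
          by (simp add: s_def power2_eq_square algebra_simps)
        moreover have "\<rho> * s \<le> \<rho> * (r + s)" using \<rho> r(1) by (intro mult_left_mono) auto
        \<comment> \<open>The mirror image of the inner estimate: \<open>(norm h)^2\<close> again
          pays for the remainder, and the surplus \<open>\<rho> * s\<close> supplies the gain
          \<open>\<epsilon>\<close>.\<close>
        ultimately have "(norm h)\<^sup>2 + \<rho> * s \<le> 2 * s * (h \<bullet> n)" by linarith
        then have "g * ((norm h)\<^sup>2 + \<rho> * s) \<le> g * (2 * s * (h \<bullet> n))"
          using g_pos by simp
        moreover have "2 * s * (M * (norm h)\<^sup>2) \<le> g * (norm h)\<^sup>2"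
        proof -
          have "2 * s * M \<le> 2 * (2 * r) * M" using s M by (intro mult_right_mono) auto
          then have "2 * s * M \<le> g" using r(3) g\<kappa> by (simp add: algebra_simps)
          then have "(2 * s * M) * (norm h)\<^sup>2 \<le> g * (norm h)\<^sup>2" by (intro mult_right_mono) auto
          then show ?thesis by (simp add: algebra_simps)
        qed
        moreover have "\<kappa> * (\<rho> * s) \<le> g * (\<rho> * s)"
          using g\<kappa> \<rho> s by (intro mult_right_mono) auto
        ultimately have "s * (\<kappa> * \<rho>) \<le> s * (2 * (g * (h \<bullet> n) - M * (norm h)\<^sup>2))"
          by (simp add: algebra_simps)
        then have "\<kappa> * \<rho> \<le> 2 * (g * (h \<bullet> n) - M * (norm h)\<^sup>2)" using s(1) by simp
        moreover have "\<kappa> * \<rho> = 2 * \<epsilon>" using \<kappa> by (simp add: \<rho>_def)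
        ultimately have "1 \<le> H (z + h)" using lower[OF h1] unfolding \<epsilon>_def by argo
        then show ?thesis by (simp add: h_def)
      qed
      then show ?thesis by (force simp: oval_def)
    qed
    ultimately have "\<exists>a. dist a z \<le> r + c * \<delta> \<and> oval \<inter> cball a r = {}"
      by (intro exI[of _ a']) auto
    then show ?thesis
      using \<delta> \<open>a \<in> K\<close> \<open>ball a (dist a z + \<delta>) \<subseteq> oval\<close> by blast
  qed
  have "compact K" unfolding K_def using \<eta> by (intro compact_sublevel) auto
  moreover have "K \<subseteq> oval" using \<eta> by (auto simp: K_def oval_def)
  moreover have "c \<ge> 0" using G_pos \<kappa> by (simp add: c_def)
  ultimately show ?thesis using r(1) near by (intro that[of K r c]) auto
qed

lemma poly_in_AC_oval: "poly p \<in> AC oval"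
proof -
  have "simply_connected oval" by (rule starlike_imp_simply_connected[OF starlike_oval])
  moreover have "oval \<noteq> UNIV"
    using bounded_oval not_bounded_UNIV by metis
  moreover have "oval \<noteq> {}" using zero_in_oval by blast
  ultimately obtain f \<phi> where hol: "\<phi> holomorphic_on ball 0 1"
    and f: "\<forall>z\<in>oval. f z \<in> ball 0 1 \<and> \<phi> (f z) = z"
    and g: "\<forall>w\<in>ball 0 1. \<phi> w \<in> oval \<and> f (\<phi> w) = w"
    using Riemann_mapping_theorem[of oval] open_oval by auto
  have "inj_on \<phi> (ball 0 1)" by (rule inj_on_inverseI[of _ f]) (use g in blast)
  moreover have "oval \<subseteq> \<phi> ` ball 0 1"
  proof
    fix z assume "z \<in> oval"
    with f have "f z \<in> ball 0 1" "z = \<phi> (f z)" by auto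
    then show "z \<in> \<phi> ` ball 0 1" by (rule rev_image_eqI)
  qed
  ultimately have \<phi>: "conformal_map_of_disc \<phi> oval"
    unfolding conformal_map_of_disc_def using hol g by blast
  show ?thesis
  proof (rule near_boundary_balls)
    fix K r c
    assume "compact K" "K \<subseteq> oval" "r > 0" "c \<ge> 0"
      "\<And>z. z \<in> oval - K \<Longrightarrow> \<exists>\<delta>>0. (\<exists>a\<in>K. ball a (dist a z + \<delta>) \<subseteq> oval) \<and>
        (\<exists>a. dist a z \<le> r + c * \<delta> \<and> oval \<inter> cball a r = {})"
    then show ?thesis
    proof (rule conformal_deriv_bounded[OF \<phi> bounded_oval])
      fix M assume "\<And>w. norm w < 1 \<Longrightarrow> norm (deriv \<phi> w) \<le> M"
      with \<phi> show ?thesis by (rule poly_in_AC_if_deriv_bounded)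
    qed
  qed
qed

end

section \<open>The boundary curve and its order\<close>

lemma poly_eval_bounded_degree:
  fixes p :: "'a::comm_semiring_1 poly"
  assumes "\<And>i. i > n \<Longrightarrow> coeff p i = 0"
  shows "poly p x = (\<Sum>i\<le>n. coeff p i * x ^ i)"
proof -
  have "degree p \<le> n" by (rule degree_le) (use assms in auto)
  then have "poly p x = poly (\<Sum>i\<le>n. monom (coeff p i) i) x"
    by (simp only: poly_as_sum_of_monoms')
  then show ?thesis by (simp add: poly_sum poly_monom)
qed

lemma finite_total_degree_set: "finite {i + j |i j. coeff (coeff P j) i \<noteq> 0}"
proof -
  have "{i + j |i j. coeff (coeff P j) i \<noteq> 0}
      \<subseteq> (\<lambda>(i, j). i + j) ` (SIGMA i:{..Max (degree ` coeff P ` {..degree P})}. {..degree P})"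
  proof
    fix n assume "n \<in> {i + j |i j. coeff (coeff P j) i \<noteq> 0}"
    then obtain i j where n: "n = i + j" and nz: "coeff (coeff P j) i \<noteq> 0" by blast
    then have j: "j \<le> degree P" by (metis coeff_0 le_degree)
    have "i \<le> degree (coeff P j)" using nz by (rule le_degree)
    also have "\<dots> \<le> Max (degree ` coeff P ` {..degree P})" using j by (intro Max_ge) auto
    finally show "n \<in> (\<lambda>(i, j). i + j) `
        (SIGMA i:{..Max (degree ` coeff P ` {..degree P})}. {..degree P})"
      using j n by force
  qed
  then show ?thesis by (rule finite_subset) auto
qed

lemma coeff_eq_0_above_total_degree:
  assumes "total_degree P < i + j"
  shows "coeff (coeff P j) i = 0"
proof (rule ccontr)
  assume "coeff (coeff P j) i \<noteq> 0"
  then have "i + j \<le> total_degree P"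
    unfolding total_degree_def by (intro Max_ge finite_total_degree_set) auto
  with assms show False by simp
qed

lemma eval_xy_cubic:
  assumes "total_degree P < 4" and a_def: "\<And>i j. a i j = coeff (coeff P j) i"
  shows "eval_xy P x y = a 0 0 + a 1 0 * x + a 2 0 * x^2 + a 3 0 * x^3
    + a 0 1 * y + a 1 1 * x * y + a 2 1 * x^2 * y + a 0 2 * y^2 + a 1 2 * x * y^2 + a 0 3 * y^3"
proof -
  have z: "a i j = 0" if "3 < i + j" for i j
    unfolding a_def using assms(1) that by (intro coeff_eq_0_above_total_degree) simp
  have P: "poly P q = (\<Sum>j\<le>3. coeff P j * q ^ j)" for q
    by (rule poly_eval_bounded_degree) (use z in \<open>auto simp: poly_eq_iff a_def\<close>)
  have Pj: "poly (coeff P j) u = (\<Sum>i\<le>3. a i j * u ^ i)" for j u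
    unfolding a_def by (rule poly_eval_bounded_degree) (use z[of _ j] in \<open>auto simp: a_def\<close>)
  have "eval_xy P x y = (\<Sum>j\<le>3. (\<Sum>i\<le>3. a i j * x ^ i) * y ^ j)"
    unfolding eval_xy_def P by (simp add: poly_sum poly_power Pj)
  then show ?thesis
    by (simp add: eval_nat_numeral z[simplified eval_nat_numeral] algebra_simps)
qed

lemma powr_minus_quarter_power4:
  fixes a :: real
  assumes "a > 0"
  shows "(a powr (- 1 / 4)) ^ 4 * a = 1"
proof -
  have "(a powr (- 1 / 4)) ^ 4 = a powr (- 1)" using assms by (simp add: powr_power)
  then show ?thesis using assms by (simp add: powr_minus)
qed

context quartic_oval
begin

section \<open>Topology of the oval and its boundary\<close>

lemma unbounded_component_outside_oval:
  assumes "H z > 1" and S: "S \<subseteq> {z. H z \<le> 1}"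
  shows "\<not> bounded (connected_component_set (- S) z)"
proof
  assume bd: "bounded (connected_component_set (- S) z)"
  \<comment> \<open>The outward radial ray stays where \<open>H > 1\<close>. The set
    \<open>S\<close> is left general because both the curve and the closed region are inserted for
    it.\<close>
  let ?r = "(\<lambda>t. of_real t * z) ` {1::real..}"
  have sub: "?r \<subseteq> - S"
  proof
    fix w assume "w \<in> ?r"
    then obtain t where t: "t \<ge> 1" "w = of_real t * z" by auto
    then have "t ^ 4 * H z \<ge> 1 * H z" using assms(1) by (intro mult_right_mono) auto
    then have "H w > 1" using assms(1) unfolding t(2) H_of_real_mult by linarith
    then show "w \<in> - S" using S by auto
  qed
  have "connected ?r"
    by (intro connected_continuous_image continuous_intros) simp
  moreover have "z \<in> ?r" by (auto intro!: image_eqI[of _ _ 1])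
  ultimately have "?r \<subseteq> connected_component_set (- S) z"
    using sub by (intro connected_component_maximal)
  then have "bounded ?r" using bd bounded_subset by blast
  then obtain B where B: "\<And>t. t \<ge> 1 \<Longrightarrow> norm (of_real t * z) \<le> B"
    unfolding bounded_iff by auto
  have z: "norm z > 0" using assms(1) by auto
  have "norm (of_real (max 1 ((B + 1) / norm z)) * z) \<le> B" by (rule B) simp
  moreover have "(B + 1) / norm z * norm z \<le> norm (of_real (max 1 ((B + 1) / norm z)) * z)"
    unfolding norm_mult norm_of_real using z by (intro mult_right_mono) auto
  ultimately show False using z by simp
qed

text \<open>The open sets \<open>H < 1\<close> and \<open>H > 1\<close> split the complement of the
  curve: the first is bounded, and radial rays make every component in the second unbounded.\<close>

lemma inside_level_curve: "inside level_curve = oval"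
proof
  show "inside level_curve \<subseteq> oval"
  proof
    fix z assume "z \<in> inside level_curve"
    then have "H z \<noteq> 1" "bounded (connected_component_set (- level_curve) z)"
      by (auto simp: inside_def level_curve_def)
    then have "H z < 1"
      using unbounded_component_outside_oval[of z level_curve]
      by (force simp: level_curve_def)
    then show "z \<in> oval" by (simp add: oval_def)
  qed
  show "oval \<subseteq> inside level_curve"
  proof
    fix z assume z: "z \<in> oval"
    let ?C = "connected_component_set (- level_curve) z"
    have z_in: "z \<in> ?C" using z by (auto simp: oval_def level_curve_def)
    have "?C \<subseteq> oval"
    proof (rule ccontr)
      assume "\<not> ?C \<subseteq> oval"
      have "open {z. 1 < H z}" by (intro open_Collect_less continuous_intros)
      moreover have "?C \<subseteq> oval \<union> {z. 1 < H z}"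
        using connected_component_subset[of "- level_curve" z]
        by (auto simp: oval_def level_curve_def)
      ultimately show False
        using connectedD[OF connected_connected_component open_oval, of "{z. 1 < H z}" "- level_curve" z]
          z z_in \<open>\<not> ?C \<subseteq> oval\<close> by (fastforce simp: oval_def)
    qed
    then have "bounded ?C" using bounded_oval bounded_subset by blast
    then show "z \<in> inside level_curve"
      using z by (auto simp: inside_def oval_def level_curve_def)
  qed
qed

lemma closure_oval: "closure oval = {z. H z \<le> 1}"
proof
  show "closure oval \<subseteq> {z. H z \<le> 1}"
    by (rule closure_minimal[OF _ closed_sublevel]) (auto simp: oval_def)
  show "{z. H z \<le> 1} \<subseteq> closure oval"
  proof
    fix z assume z: "z \<in> {z. H z \<le> 1}"
    have "((\<lambda>t. of_real t * z) \<longlongrightarrow> of_real 1 * z) (at_left (1::real))"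
      by (intro tendsto_intros)
    moreover have "\<forall>\<^sub>F t in at_left (1::real). of_real t * z \<in> closure oval"
      using eventually_at_left_real[of 0 1]
      by (rule eventually_mono, simp)
        (use z scale_in_oval closure_subset in \<open>auto intro!: subsetD[OF closure_subset]\<close>)
    ultimately have "of_real 1 * z \<in> closure oval"
      by (intro Lim_in_closed_set[OF closed_closure]) auto
    then show "z \<in> closure oval" by simp
  qed
qed

lemma frontier_oval: "frontier oval = level_curve"
  unfolding frontier_def closure_oval interior_open[OF open_oval]
  by (auto simp: oval_def level_curve_def)

lemma outside_closure_oval: "outside (closure oval) = {z. H z > 1}"
  using unbounded_component_outside_oval[of _ "closure oval"]
  by (auto simp: outside_def closure_oval)

lemma frontier_outside_closure_oval: "frontier (outside (closure oval)) = level_curve"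
proof -
  have "closure {z. H z > 1} = {z. H z \<ge> 1}"
  proof
    show "closure {z. H z > 1} \<subseteq> {z. H z \<ge> 1}"
      by (rule closure_minimal) (auto intro!: closed_Collect_le continuous_intros)
    show "{z. H z \<ge> 1} \<subseteq> closure {z. H z > 1}"
    proof
      fix z assume z: "z \<in> {z. H z \<ge> 1}"
      have "((\<lambda>t. of_real t * z) \<longlongrightarrow> of_real 1 * z) (at_right (1::real))"
        by (intro tendsto_intros)
      moreover have "of_real t * z \<in> closure {z. H z > 1}" if t: "t > 1" for t :: real
      proof -
        have "1 < t ^ 4" using t by (simp add: one_less_power)
        also have "\<dots> \<le> t ^ 4 * H z" using mult_left_mono[of 1 "H z" "t ^ 4"] z by simp
        finally show ?thesis
          by (intro subsetD[OF closure_subset]) (simp add: H_of_real_mult)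
      qed
      then have "\<forall>\<^sub>F t in at_right (1::real). of_real t * z \<in> closure {z. H z > 1}"
        by (auto simp: eventually_at_filter)
      ultimately have "of_real 1 * z \<in> closure {z. H z > 1}"
        by (intro Lim_in_closed_set[OF closed_closure]) auto
      then show "z \<in> closure {z. H z > 1}" by simp
    qed
  qed
  moreover have "open {z. H z > 1}" by (intro open_Collect_less continuous_intros)
  ultimately show ?thesis
    by (auto simp: frontier_def outside_closure_oval interior_open level_curve_def)
qed

lemma caratheodory_domain_oval: "caratheodory_domain oval"
  unfolding caratheodory_domain_def
  using open_oval bounded_oval zero_in_oval
    starlike_imp_connected[OF starlike_oval] frontier_oval frontier_outside_closure_oval
  by blast

text \<open>Radial projection of the unit circle: by homogeneity of degree 4 the factor
  \<open>H z powr (- 1 / 4)\<close> lands on the curve. The norm of the image is that factor, whence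
  injectivity.\<close>

lemma jordan_curve_level_curve: "jordan_curve level_curve"
proof -
  define f where "f = (\<lambda>z::complex. of_real (H z powr (- 1 / 4)) * z)"
  have pos: "H z > 0" if "norm z = 1" for z using that by (intro H_pos) auto
  have cont: "continuous_on (sphere 0 1) f"
    unfolding f_def by (intro continuous_intros) (use pos in \<open>force\<close>)
  have norm_f: "norm (f z) = H z powr (- 1 / 4)" if "norm z = 1" for z
    using that by (simp add: f_def norm_mult)
  have "inj_on f (sphere 0 1)"
  proof (rule inj_onI)
    fix z w :: complex assume z: "z \<in> sphere 0 1" and w: "w \<in> sphere 0 1" and eq: "f z = f w"
    then have "H z powr (- 1 / 4) = H w powr (- 1 / 4)" using norm_f by (metis mem_sphere_0)
    then show "z = w" using eq pos[of z] pos[of w] z w by (simp add: f_def)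
  qed
  moreover have "f ` sphere 0 1 = level_curve"
  proof
    show "f ` sphere 0 1 \<subseteq> level_curve"
    proof
      fix u assume "u \<in> f ` sphere 0 1"
      then obtain z where z: "norm z = 1" "u = f z" by auto
      have "H u = (H z powr (- 1 / 4)) ^ 4 * H z" by (simp add: z f_def H_of_real_mult)
      also have "\<dots> = 1" by (rule powr_minus_quarter_power4[OF pos[OF z(1)]])
      finally show "u \<in> level_curve" by (simp add: level_curve_def)
    qed
    show "level_curve \<subseteq> f ` sphere 0 1"
    proof
      fix u assume u: "u \<in> level_curve"
      then have nz: "u \<noteq> 0" by (auto simp: level_curve_def)
      define z where "z = of_real (inverse (norm u)) * u"
      have z: "norm z = 1" using nz by (simp add: z_def norm_mult norm_inverse)
      have "H z = (inverse (norm u)) ^ 4"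
        unfolding z_def H_of_real_mult using u by (simp add: level_curve_def)
      also have "\<dots> = norm u powr (- 4)"
        using nz by (simp add: powr_minus power_inverse)
      finally have "H z powr (- 1 / 4) = norm u" using nz by (simp add: powr_powr)
      then have "f z = u" using nz by (simp add: f_def z_def field_simps)
      then show "u \<in> f ` sphere 0 1" using z by force
    qed
  qed
  ultimately show ?thesis
    unfolding jordan_curve_def
    using cont simple_path_continuous_image[of "circlepath 0 1" f]
    by (intro exI[of _ "f \<circ> circlepath 0 1"])
      (simp add: simple_path_circlepath path_image_compose pathfinish_compose pathstart_compose)
qed

section \<open>A quartic equation of the curve and the exclusion of lower degrees\<close>

definition defining_poly :: "complex poly poly" where
  "defining_poly = monom (monom (of_real A) 4) 0 - monom (monom (of_real (2 * C)) 2) 2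
    + monom (monom (of_real B) 0) 4 - 1"

lemma coeff_defining_poly:
  "coeff (coeff defining_poly j) i =
    (if j = 0 \<and> i = 4 then of_real A else 0) - (if j = 2 \<and> i = 2 then of_real (2 * C) else 0)
    + (if j = 4 \<and> i = 0 then of_real B else 0) - (if j = 0 \<and> i = 0 then 1 else 0)"
  by (simp add: defining_poly_def coeff_1)

lemma defines_curve_defining_poly: "defines_curve defining_poly level_curve"
proof -
  have "eval_xy defining_poly (Re z) (Im z) = of_real (H z - 1)" for z
    by (simp add: eval_xy_def defining_poly_def H_def poly_monom poly_power algebra_simps)
  moreover have "coeff (coeff defining_poly 0) 4 \<noteq> 0"
    using A_pos by (simp add: coeff_defining_poly)
  then have "defining_poly \<noteq> 0" by auto
  ultimately show ?thesis by (simp add: defines_curve_def level_curve_def)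
qed

lemma total_degree_defining_poly: "total_degree defining_poly = 4"
  unfolding total_degree_def
proof (rule Max_eqI[OF finite_total_degree_set])
  have "coeff (coeff defining_poly 0) 4 \<noteq> 0"
    using A_pos by (simp add: coeff_defining_poly)
  then show "4 \<in> {i + j |i j. coeff (coeff defining_poly j) i \<noteq> 0}"
    by (intro CollectI exI[of _ 4] exI[of _ 0]) simp
next
  fix n assume "n \<in> {i + j |i j. coeff (coeff defining_poly j) i \<noteq> 0}"
  then obtain i j where "n = i + j" "coeff (coeff defining_poly j) i \<noteq> 0" by blast
  then show "n \<le> 4" by (auto simp: coeff_defining_poly split: if_splits)
qed

text \<open>On the ray \<open>y\<^sup>2 = k x\<^sup>2\<close> the curve has \<open>x\<^sup>4 = 1 / (A - 2 C k + B k\<^sup>2)\<close>, so the relation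
  squares to a polynomial identity in \<open>k\<close>.\<close>

lemma level_curve_no_even_conic:
  fixes \<alpha> \<beta> \<gamma> :: complex
  assumes on: "\<And>x y. x > 0 \<Longrightarrow> y > 0 \<Longrightarrow> Complex x y \<in> level_curve \<Longrightarrow>
    \<alpha> + \<beta> * (of_real x)\<^sup>2 + \<gamma> * (of_real y)\<^sup>2 = 0"
  shows "\<alpha> = 0 \<and> \<beta> = 0 \<and> \<gamma> = 0"
proof -
  have ray: "\<alpha>\<^sup>2 * (of_real A - 2 * of_real C * of_real k + of_real B * (of_real k)\<^sup>2)
      = (\<beta> + \<gamma> * of_real k)\<^sup>2" if k: "k > 0" for k :: real
  proof -
    define w where "w = Complex 1 (sqrt k)"
    have Hw: "H w = A - 2 * C * k + B * k\<^sup>2"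
      using k by (simp add: H_def w_def power4_eq_xxxx power2_eq_square mult.assoc)
    have pos: "H w > 0" by (rule H_pos) (simp add: w_def complex_eq_iff)
    define x where "x = H w powr (- 1 / 4)"
    have x: "x > 0" using pos by (simp add: x_def)
    have x4: "x ^ 4 * H w = 1"
      unfolding x_def by (rule powr_minus_quarter_power4[OF pos])
    have "Complex x (x * sqrt k) = of_real x * w" by (simp add: w_def complex_eq_iff)
    then have "Complex x (x * sqrt k) \<in> level_curve"
      using x4 by (simp add: level_curve_def H_of_real_mult)
    from on[OF x _ this] have "\<alpha> + \<beta> * (of_real x)\<^sup>2 + \<gamma> * (of_real (x * sqrt k))\<^sup>2 = 0"
      using x k by simp
    also have "(of_real (x * sqrt k))\<^sup>2 = (of_real x)\<^sup>2 * (of_real k :: complex)"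
      using k by (simp add: power_mult_distrib flip: of_real_power)
    finally have "- \<alpha> = (of_real x)\<^sup>2 * (\<beta> + \<gamma> * of_real k)"
      by algebra
    then have "\<alpha>\<^sup>2 = ((of_real x)\<^sup>2 * (\<beta> + \<gamma> * of_real k))\<^sup>2" by (metis power2_minus)
    then have "\<alpha>\<^sup>2 * of_real (H w) = of_real (x ^ 4 * H w) * (\<beta> + \<gamma> * of_real k)\<^sup>2"
      by (simp add: power2_eq_square power4_eq_xxxx)
    then have "\<alpha>\<^sup>2 * of_real (H w) = (\<beta> + \<gamma> * of_real k)\<^sup>2" unfolding x4 by simp
    then show ?thesis by (simp add: Hw)
  qed
  \<comment> \<open>Both sides have degree at most 2 in \<open>k\<close>, so three rays determine
    all coefficients.\<close>
  have r1: "\<alpha>\<^sup>2 * (of_real A - 2 * of_real C + of_real B) = (\<beta> + \<gamma>)\<^sup>2"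
    using ray[of 1] by simp
  have r2: "\<alpha>\<^sup>2 * (of_real A - 4 * of_real C + 4 * of_real B) = (\<beta> + 2 * \<gamma>)\<^sup>2"
    using ray[of 2] by (simp add: mult.commute)
  have r3: "\<alpha>\<^sup>2 * (of_real A - 6 * of_real C + 9 * of_real B) = (\<beta> + 3 * \<gamma>)\<^sup>2"
    using ray[of 3] by (simp add: mult.commute)
  have B2: "\<alpha>\<^sup>2 * of_real B = \<gamma>\<^sup>2" and A2: "\<alpha>\<^sup>2 * of_real A = \<beta>\<^sup>2"
    and C2: "\<alpha>\<^sup>2 * of_real C = - (\<beta> * \<gamma>)"
    using r1 r2 r3 by algebra+
  \<comment> \<open>The right-hand side of \<open>ray\<close> is a square, so its discriminant in
    \<open>k\<close> vanishes; that of the left-hand side is a multiple of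
    \<open>C^2 - A * B\<close>.\<close>
  have "\<alpha> ^ 4 * of_real (A * B - C\<^sup>2) = 0"
    using A2 B2 C2 unfolding of_real_diff of_real_mult of_real_power by algebra
  then have "\<alpha> = 0" using disc by (simp del: of_real_diff of_real_mult of_real_power)
  then show ?thesis using A2 B2 by simp
qed

text \<open>The curve is invariant under reflection in both axes, so the four parity components of a
  cubic vanish on it separately. Three of them, freed of a factor \<open>x\<close> or
  \<open>y\<close>, are even conics; the one odd in both variables is a multiple of
  \<open>x y\<close>.\<close>

lemma no_cubic_defines_level_curve:
  assumes "defines_curve P level_curve"
  shows "4 \<le> total_degree P"
proof (rule ccontr)
  assume "\<not> 4 \<le> total_degree P"
  then have deg: "total_degree P < 4" by simp
  define a where "a = (\<lambda>i j. coeff (coeff P j) i)"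
  have a_eq: "a i j = coeff (coeff P j) i" for i j by (simp add: a_def)
  note ev = eval_xy_cubic[OF deg a_eq]
  have sym: "eval_xy P (s * x) (t * y) = 0"
    if "Complex x y \<in> level_curve" "s\<^sup>2 = 1" "t\<^sup>2 = 1" for x y s t
  proof -
    have "s ^ 4 = (s\<^sup>2)\<^sup>2" "t ^ 4 = (t\<^sup>2)\<^sup>2" by simp_all
    then have "H (Complex (s * x) (t * y)) = H (Complex x y)"
      using that(2,3) by (simp add: H_def power_mult_distrib)
    then have "Complex (s * x) (t * y) \<in> level_curve" using that(1) by (simp add: level_curve_def)
    then show ?thesis using assms by (fastforce simp: defines_curve_def)
  qed
  have parts: "a 0 0 + a 2 0 * (of_real x)\<^sup>2 + a 0 2 * (of_real y)\<^sup>2 = 0"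
    "a 1 0 + a 3 0 * (of_real x)\<^sup>2 + a 1 2 * (of_real y)\<^sup>2 = 0"
    "a 0 1 + a 2 1 * (of_real x)\<^sup>2 + a 0 3 * (of_real y)\<^sup>2 = 0"
    "a 1 1 = 0"
    if xy: "x > 0" "y > 0" "Complex x y \<in> level_curve" for x y
  proof -
    define X Y where "X = complex_of_real x" "Y = complex_of_real y"
    note XY = this
    have nz: "X \<noteq> 0" "Y \<noteq> 0" using xy by (auto simp: XY)
    have pp: "a 0 0 + a 1 0 * X + a 2 0 * X^2 + a 3 0 * X^3 + a 0 1 * Y + a 1 1 * X * Y
        + a 2 1 * X^2 * Y + a 0 2 * Y^2 + a 1 2 * X * Y^2 + a 0 3 * Y^3 = 0"
      using sym[OF xy(3), of 1 1] by (simp add: ev XY)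
    have mp: "a 0 0 - a 1 0 * X + a 2 0 * X^2 - a 3 0 * X^3 + a 0 1 * Y - a 1 1 * X * Y
        + a 2 1 * X^2 * Y + a 0 2 * Y^2 - a 1 2 * X * Y^2 + a 0 3 * Y^3 = 0"
      using sym[OF xy(3), of "-1" 1] by (simp add: ev XY)
    have pm: "a 0 0 + a 1 0 * X + a 2 0 * X^2 + a 3 0 * X^3 - a 0 1 * Y - a 1 1 * X * Y
        - a 2 1 * X^2 * Y + a 0 2 * Y^2 + a 1 2 * X * Y^2 - a 0 3 * Y^3 = 0"
      using sym[OF xy(3), of 1 "-1"] by (simp add: ev XY)
    have mm: "a 0 0 - a 1 0 * X + a 2 0 * X^2 - a 3 0 * X^3 - a 0 1 * Y + a 1 1 * X * Y
        - a 2 1 * X^2 * Y + a 0 2 * Y^2 - a 1 2 * X * Y^2 - a 0 3 * Y^3 = 0"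
      using sym[OF xy(3), of "-1" "-1"] by (simp add: ev XY)
    have "a 0 0 + a 2 0 * X\<^sup>2 + a 0 2 * Y\<^sup>2 = 0" using pp mp pm mm by algebra
    moreover have "X * (a 1 0 + a 3 0 * X\<^sup>2 + a 1 2 * Y\<^sup>2) = 0" using pp mp pm mm by algebra
    moreover have "Y * (a 0 1 + a 2 1 * X\<^sup>2 + a 0 3 * Y\<^sup>2) = 0" using pp mp pm mm by algebra
    moreover have "X * Y * a 1 1 = 0" using pp mp pm mm by algebra
    ultimately show "a 0 0 + a 2 0 * (of_real x)\<^sup>2 + a 0 2 * (of_real y)\<^sup>2 = 0"
      "a 1 0 + a 3 0 * (of_real x)\<^sup>2 + a 1 2 * (of_real y)\<^sup>2 = 0"
      "a 0 1 + a 2 1 * (of_real x)\<^sup>2 + a 0 3 * (of_real y)\<^sup>2 = 0" "a 1 1 = 0"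
      using nz by (simp_all add: XY)
  qed
  have "a 0 0 = 0 \<and> a 2 0 = 0 \<and> a 0 2 = 0" "a 1 0 = 0 \<and> a 3 0 = 0 \<and> a 1 2 = 0"
    "a 0 1 = 0 \<and> a 2 1 = 0 \<and> a 0 3 = 0"
    using level_curve_no_even_conic parts(1-3) by blast+
  \<comment> \<open>The fourth relation presupposes a point of the curve in the open quadrant; the
    diagonal supplies one.\<close>
  moreover have "a 1 1 = 0"
  proof -
    define w where "w = Complex 1 1"
    have "H w > 0" by (rule H_pos) (simp add: w_def complex_eq_iff)
    define x where "x = H w powr (- 1 / 4)"
    have "Complex x x = of_real x * w" by (simp add: w_def complex_eq_iff)
    moreover have "x ^ 4 * H w = 1" "x > 0"
      using \<open>H w > 0\<close> powr_minus_quarter_power4 by (simp_all add: x_def)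
    ultimately show ?thesis using parts(4)[of x x] by (simp add: level_curve_def H_of_real_mult)
  qed
  ultimately have low: "a i j = 0" if "i \<le> 3" "j \<le> 3" "i + j \<le> 3" for i j
    using that by (auto simp: eval_nat_numeral le_Suc_eq)
  have "a i j = 0" for i j
  proof (cases "i + j \<le> 3")
    case False
    then show ?thesis unfolding a_def using deg by (intro coeff_eq_0_above_total_degree) auto
  qed (use low in auto)
  then have "P = 0" by (simp add: a_def poly_eq_iff)
  then show False using assms by (simp add: defines_curve_def)
qed

lemma curve_order_level_curve: "curve_order level_curve = 4"
  unfolding curve_order_def
  using defines_curve_defining_poly total_degree_defining_poly no_cubic_defines_level_curve
  by (intro Least_equality) auto

lemma domain_with_algebraic_boundary_oval: "domain_with_algebraic_boundary oval level_curve"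
  unfolding domain_with_algebraic_boundary_def algebraic_jordan_curve_def
  using jordan_curve_level_curve defines_curve_defining_poly inside_level_curve by blast

end

section \<open>The quintic example\<close>

lemma has_boundary_value_continuous:
  assumes "isCont f \<zeta>"
  shows "has_boundary_value D f \<zeta> (f \<zeta>)"
  unfolding has_boundary_value_def
proof (intro allI impI)
  fix \<gamma> assume \<gamma>: "access_path D \<zeta> \<gamma>"
  then have "continuous_on {0..1} \<gamma>" by (simp add: access_path_def path_def)
  then have "(\<gamma> \<longlongrightarrow> \<gamma> 1) (at 1 within {0..1})"
    by (simp add: continuous_on_def)
  then have "(\<gamma> \<longlongrightarrow> \<gamma> 1) (at_left 1)"
    by (simp add: at_within_Icc_at_left)
  then show "((f \<circ> \<gamma>) \<longlongrightarrow> f \<zeta>) (at_left 1)"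
    using \<gamma> isCont_tendsto_compose[OF assms] by (simp add: access_path_def pathfinish_def o_def)
qed

lemma poly_not_constant_on_open:
  fixes p :: "complex poly"
  assumes "open S" "S \<noteq> {}" "degree p \<noteq> 0"
  shows "\<not> poly p constant_on S"
proof
  assume "poly p constant_on S"
  then obtain c where "\<And>z. z \<in> S \<Longrightarrow> poly p z = c" by (auto simp: constant_on_def)
  then have sub: "S \<subseteq> {z. poly (p - [:c:]) z = 0}" by auto
  have "p - [:c:] \<noteq> 0" using assms(3) by auto
  then have "finite S" using sub poly_roots_finite finite_subset by blast
  then show False using assms(1,2) using finite_imp_not_open by blast
qed

text \<open>For the involution \<open>\<sigma> z = Complex (Im z / b) (b * Re z)\<close> one has
  \<open>T_map (b^2) z = (i / b) * cnj (\<sigma> z)\<close>. The stretched domain is thus similar to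
  \<open>D\<close>, so one Riemann map serves both AC conditions.\<close>

lemma T_map_image_scale:
  assumes "\<And>z. z \<in> D \<Longrightarrow> Complex (Im z / b) (b * Re z) \<in> D" "\<And>z. z \<in> D \<Longrightarrow> cnj z \<in> D" "b > 0"
  shows "T_map (b\<^sup>2) ` D = (*) (\<i> / of_real b) ` D"
proof
  show "T_map (b\<^sup>2) ` D \<subseteq> (*) (\<i> / of_real b) ` D"
  proof
    fix w assume "w \<in> T_map (b\<^sup>2) ` D"
    then obtain z where z: "z \<in> D" "w = T_map (b\<^sup>2) z" by auto
    have "w = \<i> / of_real b * cnj (Complex (Im z / b) (b * Re z))"
      using assms(3) by (simp add: z(2) T_map_def complex_eq_iff power2_eq_square)
    then show "w \<in> (*) (\<i> / of_real b) ` D" using assms(1,2) z(1) by blast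
  qed
  show "(*) (\<i> / of_real b) ` D \<subseteq> T_map (b\<^sup>2) ` D"
  proof
    fix w assume "w \<in> (*) (\<i> / of_real b) ` D"
    then obtain z where z: "z \<in> D" "w = \<i> / of_real b * z" by auto
    have "w = T_map (b\<^sup>2) (Complex (Im (cnj z) / b) (b * Re (cnj z)))"
      using assms(3) by (simp add: z(2) T_map_def complex_eq_iff power2_eq_square)
    then show "w \<in> T_map (b\<^sup>2) ` D" using assms(1,2) z(1) by blast
  qed
qed

text \<open>The values at 0 and 1 are 1 and -4. A root strictly between them places
  \<open>\<beta> = b^2\<close> in the required range.\<close>

lemma exists_palindromic_root:
  obtains b :: real where "0 < b" "b < 1" "b ^ 4 - 6 * b ^ 3 + 6 * b\<^sup>2 - 6 * b + 1 = 0"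
proof -
  let ?f = "\<lambda>b::real. b ^ 4 - 6 * b ^ 3 + 6 * b\<^sup>2 - 6 * b + 1"
  have "\<exists>b\<ge>0. b \<le> 1 \<and> ?f b = 0"
    by (rule IVT2') (auto intro!: continuous_intros)
  then obtain b where b: "b \<ge> 0" "b \<le> 1" "?f b = 0" by blast
  moreover have "b \<noteq> 0" "b \<noteq> 1" using b(3) by auto
  ultimately show ?thesis by (intro that[of b]) auto
qed

text \<open>The equation for \<open>b\<close> says that \<open>1 + b^5\<close> and
  \<open>5 b (1 + b^3)\<close> coincide, both being \<open>(1 + b) A\<close>; division by
  \<open>x + Y\<close> then leaves no terms \<open>x^3 Y\<close> and \<open>x Y^3\<close>.\<close>

lemma quintic_factorization:
  fixes b x Y A :: complex
  assumes root: "b ^ 4 - 6 * b ^ 3 + 6 * b\<^sup>2 - 6 * b + 1 = 0" and A: "A = 5 * b * (1 - b + b\<^sup>2)"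
  shows "(x + b * Y) ^ 5 + (b * x + Y) ^ 5
    = (1 + b) * (x + Y) * (A * x ^ 4 + 10 * b\<^sup>2 * x\<^sup>2 * Y\<^sup>2 + A * Y ^ 4)"
proof -
  have "1 + b ^ 5 = (1 + b) * A" using root unfolding A by algebra
  moreover have "(x + b * Y) ^ 5 + (b * x + Y) ^ 5
    = (1 + b ^ 5) * (x ^ 5 + Y ^ 5) + 5 * b * (1 + b ^ 3) * (x ^ 4 * Y + x * Y ^ 4)
      + 10 * b\<^sup>2 * (1 + b) * (x ^ 3 * Y\<^sup>2 + x\<^sup>2 * Y ^ 3)"
    by (simp add: eval_nat_numeral algebra_simps)
  moreover have "5 * b * (1 + b ^ 3) = (1 + b) * A"
    unfolding A by (simp add: eval_nat_numeral algebra_simps)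
  ultimately have "(x + b * Y) ^ 5 + (b * x + Y) ^ 5
    = (1 + b) * A * (x ^ 5 + Y ^ 5) + (1 + b) * A * (x ^ 4 * Y + x * Y ^ 4)
      + 10 * b\<^sup>2 * (1 + b) * (x ^ 3 * Y\<^sup>2 + x\<^sup>2 * Y ^ 3)" by simp
  also have "\<dots> = (1 + b) * (x + Y) * (A * x ^ 4 + 10 * b\<^sup>2 * x\<^sup>2 * Y\<^sup>2 + A * Y ^ 4)"
    by (simp add: eval_nat_numeral algebra_simps)
  finally show ?thesis .
qed

theorem theorem3:
  fixes c :: complex
  assumes "c \<noteq> 0"
  shows "\<exists>(\<beta>::real) (D::complex set) (\<Gamma>::complex set).
           0 < \<beta> \<and> \<beta> < 1 \<and>
           domain_with_algebraic_boundary D \<Gamma> \<and> curve_order \<Gamma> = 4 \<and>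
           L_special (L_op c \<beta>) D \<and>
           (\<exists>(p::complex poly) (q::complex poly).
              admissible_pair (L_op c \<beta>) D (poly p) (poly q))"
proof -
  obtain b :: real where b: "0 < b" "b < 1" and root: "b ^ 4 - 6 * b ^ 3 + 6 * b\<^sup>2 - 6 * b + 1 = 0"
    by (rule exists_palindromic_root)
  define A where "A = 5 * b * (1 - b + b\<^sup>2)"
  \<comment> \<open>Multiplied by \<open>5 * b\<close> this becomes \<open>A > 5 * b^2\<close>,
    whose square is the discriminant condition.\<close>
  have b_less: "b < 1 - b + b\<^sup>2"
  proof -
    have "0 < (1 - b)\<^sup>2" using b by simp
    then show ?thesis by (simp add: power2_eq_square algebra_simps)
  qed
  have A5: "A > 5 * b\<^sup>2"
    using mult_strict_left_mono[OF b_less, of "5 * b"] b by (simp add: A_def power2_eq_square)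
  then have A_pos: "A > 0" using b by (smt (verit) zero_less_power)
  \<comment> \<open>The parameters result from \<open>Y = i y / b\<close> in
    \<open>A x^4 + 10 b^2 x^2 Y^2 + A Y^4\<close>.\<close>
  interpret quartic_oval A "A / b ^ 4" 5
  proof
    have "(5 * b\<^sup>2)\<^sup>2 < A\<^sup>2" using A5 by (intro power_strict_mono) auto
    then have "25 * b ^ 4 < A * A" by (simp add: power_mult_distrib power2_eq_square[of A])
    then show "5\<^sup>2 < A * (A / b ^ 4)" using b by (simp add: field_simps)
  qed (use A_pos b in auto)
  define p :: "complex poly" where "p = [:0, -1, 0, 0, 0, 1:]"
  define q :: "complex poly" where "q = pcompose p [:0, of_real (- b):]"
  have p_eval: "poly p z = z ^ 5 - z" for z
    by (simp add: p_def eval_nat_numeral algebra_simps)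
  have q_eval: "poly q z = poly p (- of_real b * z)" for z
    by (simp add: q_def poly_pcompose mult.commute)
  have deg_p: "degree p = 5" by (simp add: p_def)
  have deg_q: "degree q = 5" using b by (simp add: q_def degree_pcompose deg_p)
  have TD: "T_map (b\<^sup>2) ` oval = (*) (\<i> / of_real b) ` oval"
  proof (rule T_map_image_scale)
    fix z assume z: "z \<in> oval"
    \<comment> \<open>The ratio \<open>b^4\<close> of the outer coefficients lets the map swap the
      two pure terms and fix the mixed one.\<close>
    have "H (Complex (Im z / b) (b * Re z)) = H z"
      using b by (simp add: H_def field_simps)
    then show "Complex (Im z / b) (b * Re z) \<in> oval" using z by (simp add: oval_def)
    show "cnj z \<in> oval" using z by (simp add: oval_def H_def)
  qed (use b in auto)
  have ne: "oval \<noteq> {}" using zero_in_oval by blast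
  have openTD: "open (T_map (b\<^sup>2) ` oval)"
    unfolding TD
    by (rule open_mapping_thm3[OF _ open_oval]) (use b in \<open>auto intro!: holomorphic_intros inj_onI\<close>)
  have boundary: "poly q (T_map (b\<^sup>2) \<zeta>) = poly p \<zeta>" if "\<zeta> \<in> level_curve" for \<zeta>
  proof -
    define x Y where "x = complex_of_real (Re \<zeta>)" "Y = \<i> * of_real (Im \<zeta> / b)"
    note defs = this
    let ?b = "complex_of_real b"
    have \<zeta>: "\<zeta> = x + ?b * Y" using b by (simp add: defs complex_eq_iff)
    define u where "u = ?b * x + Y"
    have T: "?b * T_map (b\<^sup>2) \<zeta> = u"
      using b by (simp add: u_def defs T_map_def complex_eq_iff power2_eq_square)
    have "of_real A * x ^ 4 + 10 * ?b\<^sup>2 * x\<^sup>2 * Y\<^sup>2 + of_real A * Y ^ 4 = of_real (H \<zeta>)"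
      using b by (simp add: defs H_def power_mult_distrib power_divide)
    also have "\<dots> = 1" using that by (simp add: level_curve_def)
    finally have one: "of_real A * x ^ 4 + 10 * ?b\<^sup>2 * x\<^sup>2 * Y\<^sup>2 + of_real A * Y ^ 4 = 1" .
    have "complex_of_real (b ^ 4 - 6 * b ^ 3 + 6 * b\<^sup>2 - 6 * b + 1) = 0" by (simp only: root of_real_0)
    then have "?b ^ 4 - 6 * ?b ^ 3 + 6 * ?b\<^sup>2 - 6 * ?b + 1 = 0" by simp
    from quintic_factorization[OF this, of "of_real A" x Y]
    have "(x + ?b * Y) ^ 5 + (?b * x + Y) ^ 5 = (1 + ?b) * (x + Y)"
      unfolding one by (simp add: A_def)
    \<comment> \<open>This is \<open>p(\<zeta>) = p(- u)\<close>, and \<open>- u\<close> is the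
      argument at which \<open>q\<close> evaluates \<open>p\<close>.\<close>
    then have "\<zeta> ^ 5 + u ^ 5 = \<zeta> + u" unfolding \<zeta> u_def by (simp add: algebra_simps)
    moreover have "poly q (T_map (b\<^sup>2) \<zeta>) = - (u ^ 5) + u"
      unfolding q_eval p_eval mult_minus_left T by simp
    ultimately show ?thesis unfolding p_eval by algebra
  qed
  have "admissible_pair (L_op c (b\<^sup>2)) oval (poly p) (poly q)"
    unfolding admissible_pair_def
  proof (rule exI[of _ c], rule exI[of _ "b\<^sup>2"], intro conjI allI impI refl)
    show "c \<noteq> 0" "0 < b\<^sup>2" "b\<^sup>2 < 1"
      using assms b by (auto simp: power_less_one_iff)
    show "poly p \<in> AC oval" by (rule poly_in_AC_oval)
    \<comment> \<open>Pulled back by the similarity, \<open>q\<close> is again a polynomial on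
      \<open>oval\<close>, and every polynomial lies in \<open>AC oval\<close>.\<close>
    show "poly q \<in> AC (T_map (b\<^sup>2) ` oval)"
      unfolding TD by (rule AC_poly_scale[OF _ poly_in_AC_oval]) (use b in auto)
    show "\<not> poly p constant_on oval"
      using open_oval ne deg_p by (intro poly_not_constant_on_open) auto
    show "\<not> poly q constant_on (T_map (b\<^sup>2) ` oval)"
      using openTD ne deg_q by (intro poly_not_constant_on_open) auto
    fix \<zeta> assume "accessible_boundary_point oval \<zeta>"
    then have "\<zeta> \<in> level_curve" by (simp add: accessible_boundary_point_def frontier_oval)
    moreover have "has_boundary_value oval (poly p) \<zeta> (poly p \<zeta>)"
      "has_boundary_value (T_map (b\<^sup>2) ` oval) (poly q) (T_map (b\<^sup>2) \<zeta>) (poly q (T_map (b\<^sup>2) \<zeta>))"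
      by (rule has_boundary_value_continuous, rule poly_isCont)+
    ultimately show "\<exists>w. has_boundary_value oval (poly p) \<zeta> w \<and>
        has_boundary_value (T_map (b\<^sup>2) ` oval) (poly q) (T_map (b\<^sup>2) \<zeta>) w"
      using boundary by auto
  qed
  moreover have "0 < b\<^sup>2" "b\<^sup>2 < 1" using b by (auto simp: power_less_one_iff)
  ultimately show ?thesis
    using domain_with_algebraic_boundary_oval curve_order_level_curve caratheodory_domain_oval
    unfolding L_special_def by blast
qed

end
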